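(* In the setting of the context, assume $\sigma_{\mathrm{eff,c}}^2=\boldsymbol{w}_{\mathrm c}^\top BB^\top\boldsymbol{w}_{\mathrm c}>0$ and $\rho_{\mathrm c}=(\boldsymbol{1}^\top\boldsymbol{v}_{\mathrm c})^2/N<1$, and let $\boldsymbol{x}=\boldsymbol{x}^*(\alpha)+\boldsymbol{z}$ with $\boldsymbol{z}\sim\mathcal{N}(\boldsymbol{0},C(\alpha))$. Let $$K_{1,\mathrm c}=\frac{\mu_3(\boldsymbol{v}_{\mathrm c})}{\mu_2(\boldsymbol{v}_{\mathrm c})^{3/2}}.$$ Then, as $\alpha\to\alpha_{\mathrm c}^-$: (i) $\operatorname{sd}[g_1]\to|K_{1,\mathrm c}|$; (ii) $g_2$ and $I_{\mathrm M}$ converge in $L^2$ to the deterministic constants $$\frac{\mu_4(\boldsymbol{v}_{\mathrm c})}{\mu_2(\boldsymbol{v}_{\mathrm c})^2}\qquad\text{and}\qquad\frac{N}{W}\,\frac{\boldsymbol{v}_{\mathrm c}^\top PAP\boldsymbol{v}_{\mathrm c}}{\boldsymbol{v}_{\mathrm c}^\top P\boldsymbol{v}_{\mathrm c}},$$ respectively, so their variances tend to zero.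
   Context: Setting. $N\ge2$. Consider the It\^o SDE $\mathrm d\boldsymbol{x}=F(\boldsymbol{x};\alpha)\,\mathrm dt+B\,\mathrm d\boldsymbol{W}$ in $\mathbb{R}^N$, with $B\in\mathbb{R}^{N\times m}$ constant, $\boldsymbol{W}$ an $m$-dimensional standard Wiener process, and $F$ sufficiently smooth in $(\boldsymbol{x},\alpha)$ ($C^2$ in a neighborhood of the equilibrium branch, including its endpoint at $\alpha_{\mathrm c}$, suffices). $\boldsymbol{x}^*(\alpha)$ is a branch of equilibria, $F(\boldsymbol{x}^*(\alpha);\alpha)=\boldsymbol{0}$, asymptotically stable for $\alpha<\alpha_{\mathrm c}$, and $M(\alpha)=-\frac{\partial F}{\partial\boldsymbol{x}}\big|_{\boldsymbol{x}=\boldsymbol{x}^*(\alpha)}$. $C=C(\alpha)$ is the stationary covariance of the linearized process $\mathrm d\boldsymbol{z}=-M\boldsymbol{z}\,\mathrm dt+B\,\mathrm d\boldsymbol{W}$, i.e. the solution of $MC+CM^\top=BB^\top$. Regular simple real critical eigenvalue assumption (in force). As $\alpha\to\alpha_{\mathrm c}^-$, $\boldsymbol{x}^*(\alpha)$ has a finite limit. For $\alpha<\alpha_{\mathrm c}$ close to $\alpha_{\mathrm c}$, $M(\alpha)$ is diagonalizable over $\mathbb{C}$ with all eigenvalues of positive real part; the eigenvalue $\lambda_1(\alpha)$ of smallest real part is real and simple, $\lambda_1(\alpha)>0$, $\lambda_1(\alpha)\to0$, and $\operatorname{Re}\lambda_k(\alpha)\ge\delta>0$ for $k=2,\dots,N$,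 with $\delta$ independent of $\alpha$. Real right and left eigenvectors $\boldsymbol{v}(\alpha),\boldsymbol{w}(\alpha)$ are chosen with $M\boldsymbol{v}=\lambda_1\boldsymbol{v}$, $\boldsymbol{w}^\top M=\lambda_1\boldsymbol{w}^\top$, $\|\boldsymbol{v}\|_2=1$, $\boldsymbol{w}^\top\boldsymbol{v}=1$, and they have finite limits $\boldsymbol{v}_{\mathrm c},\boldsymbol{w}_{\mathrm c}$ as $\alpha\to\alpha_{\mathrm c}^-$. Statistics. For $\boldsymbol{u}\in\mathbb{R}^N$: $\bar u=N^{-1}\sum_iu_i$, $\mu_k(\boldsymbol{u})=\frac1N\sum_i(u_i-\bar u)^k$. $A=(A_{ij})\in\mathbb{R}^{N\times N}$ is the fixed adjacency matrix, $W=\sum_{i,j}A_{ij}>0$. Spatial skewness $g_1=\mu_3(\boldsymbol{x})/\mu_2(\boldsymbol{x})^{3/2}$, spatial kurtosis $g_2=\mu_4(\boldsymbol{x})/\mu_2(\boldsymbol{x})^2$, Moran's $I$: $I_{\mathrm M}=\frac{N}{W}\frac{\sum_{i,j}A_{ij}(x_i-\bar x)(x_j-\bar x)}{\sum_i(x_i-\bar x)^2}$. $P=I-\frac1N\boldsymbol{1}\boldsymbol{1}^\top$. $\operatorname{sd}[\cdot]$ is the probabilistic standard deviation over the law of $\boldsymbol{z}$. *)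

theory Defs
  imports "HOL-Probability.Probability" "HOL-Computational_Algebra.Polynomial"
begin

section \<open>Smoothness and stability\<close>

definition C2_on :: "('a::real_normed_vector \<Rightarrow> 'b::real_normed_vector) \<Rightarrow> 'a set \<Rightarrow> bool" where
  "C2_on f U \<longleftrightarrow>
     (\<exists>(f1 :: 'a \<Rightarrow> ('a \<Rightarrow>\<^sub>L 'b)) (f2 :: 'a \<Rightarrow> ('a \<Rightarrow>\<^sub>L ('a \<Rightarrow>\<^sub>L 'b))).
        (\<forall>p\<in>U. (f has_derivative blinfun_apply (f1 p)) (at p)) \<and>
        (\<forall>p\<in>U. (f1 has_derivative blinfun_apply (f2 p)) (at p)) \<and>
        continuous_on U f2)"

definition solves_autonomous_ode ::
    "('a::real_normed_vector \<Rightarrow> 'a) \<Rightarrow> (real \<Rightarrow> 'a) \<Rightarrow> real set \<Rightarrow> bool" where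
  "solves_autonomous_ode f \<phi> J \<longleftrightarrow>
     (\<forall>t\<in>J. (\<phi> has_vector_derivative f (\<phi> t)) (at t within J))"

text \<open>Lyapunov stability together with local attractivity.  Stability quantifies over solutions on
  every interval \<open>[0,T)\<close>, so that it also concerns solutions not known to be global.\<close>

definition asymptotically_stable_equilibrium ::
    "('a::real_normed_vector \<Rightarrow> 'a) \<Rightarrow> 'a \<Rightarrow> bool" where
  "asymptotically_stable_equilibrium f p \<longleftrightarrow>
     f p = 0 \<and>
     (\<forall>\<epsilon>>0. \<exists>\<delta>>0. \<forall>T>0. \<forall>\<phi>.
        solves_autonomous_ode f \<phi> {0..<T} \<and> dist (\<phi> 0) p < \<delta> \<longrightarrow>
        (\<forall>t\<in>{0..<T}. dist (\<phi> t) p < \<epsilon>)) \<and>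
     (\<exists>\<delta>>0. \<forall>\<phi>.
        solves_autonomous_ode f \<phi> {0..} \<and> dist (\<phi> 0) p < \<delta> \<longrightarrow>
        (\<phi> \<longlongrightarrow> p) at_top)"


section \<open>Spectral notions for real matrices, over the complex numbers\<close>

definition complex_matrix :: "real^'n^'m \<Rightarrow> complex^'n^'m" where
  "complex_matrix M = (\<chi> i j. complex_of_real (M $ i $ j))"

definition is_eigenvalue :: "complex^'n^'n \<Rightarrow> complex \<Rightarrow> bool" where
  "is_eigenvalue M \<mu> \<longleftrightarrow> (\<exists>x. x \<noteq> 0 \<and> M *v x = \<mu> *s x)"

definition charpoly :: "complex^'n^'n \<Rightarrow> complex poly" where
  "charpoly M = det (\<chi> i j. (if i = j then [:0, 1:] else 0) - [:M $ i $ j:])"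

text \<open>Simple means of algebraic multiplicity one.\<close>

definition is_simple_eigenvalue :: "complex^'n^'n \<Rightarrow> complex \<Rightarrow> bool" where
  "is_simple_eigenvalue M \<mu> \<longleftrightarrow> is_eigenvalue M \<mu> \<and> order \<mu> (charpoly M) = 1"

definition is_diagonalizable :: "complex^'n^'n \<Rightarrow> bool" where
  "is_diagonalizable M \<longleftrightarrow>
     (\<exists>S D :: complex^'n^'n. invertible S \<and> (\<forall>i j. i \<noteq> j \<longrightarrow> D $ i $ j = 0) \<and> M = S ** D ** matrix_inv S)"


section \<open>Gaussian vectors and second-order statistics\<close>

text \<open>The normal law on the line with variance \<open>s\<close>, including the degenerate case \<open>s = 0\<close>.\<close>

definition normal_law :: "real \<Rightarrow> real \<Rightarrow> real measure" where
  "normal_law m s =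
     (if s = 0 then return borel m else density lborel (\<lambda>x. ennreal (normal_density m (sqrt s) x)))"

text \<open>\<open>X\<close> has law \<open>N(m, S)\<close>: every linear functional of \<open>X\<close> is normal with the corresponding mean and
  variance.  The covariance matrix \<open>S\<close> may be singular, so no density on the whole space is assumed.\<close>

definition gaussian_vector ::
    "'w measure \<Rightarrow> ('w \<Rightarrow> real^'n) \<Rightarrow> real^'n \<Rightarrow> real^'n^'n \<Rightarrow> bool" where
  "gaussian_vector \<Omega> X m S \<longleftrightarrow>
     prob_space \<Omega> \<and> X \<in> borel_measurable \<Omega> \<and>
     transpose S = S \<and> (\<forall>u. 0 \<le> u \<bullet> (S *v u)) \<and>
     (\<forall>u. distr \<Omega> borel (\<lambda>\<omega>. u \<bullet> X \<omega>) = normal_law (u \<bullet> m) (u \<bullet> (S *v u)))"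

definition square_integrable :: "'w measure \<Rightarrow> ('w \<Rightarrow> real) \<Rightarrow> bool" where
  "square_integrable \<Omega> X \<longleftrightarrow> X \<in> borel_measurable \<Omega> \<and> integrable \<Omega> (\<lambda>\<omega>. (X \<omega>)\<^sup>2)"

definition std_dev :: "'w measure \<Rightarrow> ('w \<Rightarrow> real) \<Rightarrow> real" where
  "std_dev \<Omega> X = sqrt (prob_space.variance \<Omega> X)"

text \<open>Convergence in \<open>L\<^sup>2\<close> of a family of random variables to a constant; the probability space
  may depend on the parameter.\<close>

definition L2_converges_to_const ::
    "('t \<Rightarrow> 'w measure) \<Rightarrow> ('t \<Rightarrow> 'w \<Rightarrow> real) \<Rightarrow> real \<Rightarrow> 't filter \<Rightarrow> bool" where
  "L2_converges_to_const \<Omega> X c F \<longleftrightarrow>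
     (\<forall>\<^sub>F t in F. square_integrable (\<Omega> t) (X t)) \<and>
     ((\<lambda>t. \<integral>\<omega>. (X t \<omega> - c)\<^sup>2 \<partial>\<Omega> t) \<longlongrightarrow> 0) F"


section \<open>Spatial statistics\<close>

definition spatial_mean :: "real^'n \<Rightarrow> real" where
  "spatial_mean u = (\<Sum>i\<in>UNIV. u $ i) / real CARD('n)"

definition central_moment :: "nat \<Rightarrow> real^'n \<Rightarrow> real" where
  "central_moment k u = (\<Sum>i\<in>UNIV. (u $ i - spatial_mean u) ^ k) / real CARD('n)"

text \<open>In the following three statistics, the value at a spatially constant \<open>x\<close> is 0 by the
  convention for division by zero.\<close>

definition spatial_skewness :: "real^'n \<Rightarrow> real" where
  "spatial_skewness x = central_moment 3 x / (central_moment 2 x) powr (3/2)"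

definition spatial_kurtosis :: "real^'n \<Rightarrow> real" where
  "spatial_kurtosis x = central_moment 4 x / (central_moment 2 x)\<^sup>2"

definition total_weight :: "real^'n^'n \<Rightarrow> real" where
  "total_weight A = (\<Sum>i\<in>UNIV. \<Sum>j\<in>UNIV. A $ i $ j)"

definition moran_I :: "real^'n^'n \<Rightarrow> real^'n \<Rightarrow> real" where
  "moran_I A x =
     real CARD('n) / total_weight A *
     ((\<Sum>i\<in>UNIV. \<Sum>j\<in>UNIV. A $ i $ j * (x $ i - spatial_mean x) * (x $ j - spatial_mean x)) /
      (\<Sum>i\<in>UNIV. (x $ i - spatial_mean x)\<^sup>2))"

definition centering_matrix :: "real^'n^'n" where
  "centering_matrix = mat 1 - (\<chi> i j. 1 / real CARD('n))"

end

theory Submission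
  imports Defs
begin

text \<open>The statistics are homogeneous of degree zero and bounded, and they are continuous at the spatially
  nonconstant vectors \<open>\<plusminus>v\<^sub>c\<close>.  Split \<open>x = s v + r\<close> with \<open>s = w \<bullet> z\<close>.  The Lyapunov equation gives
  \<open>s\<close> the variance \<open>w\<^sup>T B B\<^sup>T w / (2 \<lambda>\<^sub>1) \<rightarrow> \<infinity>\<close>, while \<open>r\<close> stays bounded in \<open>L\<^sup>2\<close>: it involves only the
  functionals \<open>a \<bullet> z\<close> with \<open>a \<bullet> v = 0\<close>, whose variances the spectral gap bounds uniformly.  So
  \<open>r / s \<rightarrow> 0\<close> in probability, and a statistic at \<open>x\<close> is asymptotically its value at \<open>sgn s \<cdot> v\<^sub>c\<close>.  For an
  even statistic this is a constant; for the odd skewness it is a fair random sign times \<open>K\<^sub>1\<close>.\<close>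

section \<open>Diagonalizable matrices with a simple real eigenvalue\<close>

text \<open>The obstacle is uniformity in \<alpha>. Each \<open>M \<alpha>\<close> has an
  eigenbasis, but nothing prevents the noncritical eigenvalues from colliding and the basis from
  becoming ill conditioned in the limit, so expanding the covariance in eigenvectors yields no
  uniform bound. What is uniform is the gap \<delta> and a bound on the entries of
  \<open>M \<alpha>\<close>, which comes from continuity of the derivative of F at the endpoint of
  the branch. The covariance estimate is therefore obtained from the Lyapunov equation by removing
  one eigenvalue at a time; the eigenbasis only decides which vectors are annihilated, never how
  large they are. Boundedness of the statistics upgrades convergence in probability to convergence
  of second moments. The skewness has no constant limit when its limiting value at \<open>vc\<close>
  is nonzero, so its standard deviation is assembled from two separate limits: its square is an even
  statistic, and its mean tends to 0 by the symmetry of s.\<close>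

lemma is_diagonalizable_intertwines:
  fixes M :: "complex^'n^'n"
  assumes "is_diagonalizable M"
  obtains S D :: "complex^'n^'n"
  where "invertible S" "\<And>i j. i \<noteq> j \<Longrightarrow> D $ i $ j = 0" "M ** S = S ** D"
proof -
  obtain S D :: "complex^'n^'n"
    where S: "invertible S" and D: "\<forall>i j. i \<noteq> j \<longrightarrow> D $ i $ j = 0"
      and M: "M = S ** D ** matrix_inv S"
    using assms unfolding is_diagonalizable_def by blast
  have "matrix_inv S ** S = mat 1"
    using S someI_ex[of "\<lambda>A'. S ** A' = mat 1 \<and> A' ** S = mat 1"]
    unfolding invertible_def matrix_inv_def by blast
  then have "M ** S = S ** D"
    unfolding M by (simp flip: matrix_mul_assoc)
  then show thesis
    using that S D by blast
qed

text \<open>Evaluation at t turns the polynomial determinant into \<open>det (mat t - M)\<close>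
  over the complex field. There the intertwining relation passes to \<open>mat t - M\<close>, and
  the nonzero factor \<open>det S\<close> cancels. Agreement at every t gives equality of
  polynomials.\<close>

lemma charpoly_eq_prod:
  fixes M S D :: "complex^'n^'n"
  assumes S: "invertible S" and D: "\<And>i j. i \<noteq> j \<Longrightarrow> D $ i $ j = 0"
    and MS: "M ** S = S ** D"
  shows "charpoly M = (\<Prod>i\<in>UNIV. [:- D $ i $ i, 1:])"
proof (rule poly_ext)
  fix t
  have charpoly: "poly (charpoly M) t = det (mat t - M)" for M :: "complex^'n^'n"
    by (auto simp add: charpoly_def det_def poly_sum poly_prod mat_def poly_of_int
        intro!: sum.cong prod.cong)
  have "mat t ** S = S ** mat t"
    by (simp add: vec_eq_iff matrix_matrix_mult_def mat_def if_distrib[of "\<lambda>x. x * _"]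
        if_distrib[of "\<lambda>x. _ * x"] mult.commute cong: if_cong)
  then have "(mat t - M) ** S = S ** (mat t - D)"
    using MS by (simp add: vec_eq_iff matrix_matrix_mult_def algebra_simps sum_subtractf)
  then have "det (mat t - M) * det S = det S * det (mat t - D)"
    by (metis det_mul)
  then have "det (mat t - M) = det (mat t - D)"
    using S by (simp add: invertible_det_nz)
  also have "\<dots> = (\<Prod>i\<in>UNIV. t - D $ i $ i)"
    by (subst det_diagonal) (auto simp: mat_def D)
  finally show "poly (charpoly M) t = poly (\<Prod>i\<in>UNIV. [:- D $ i $ i, 1:]) t"
    by (simp add: charpoly poly_prod)
qed

text \<open>Two diagonal entries equal to \<mu> would put the square of a linear factor into the
  characteristic polynomial, contradicting algebraic multiplicity one.\<close>

lemma simple_eigenvalue_diagonal_unique: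
  fixes M S D :: "complex^'n^'n"
  assumes S: "invertible S" and D: "\<And>i j. i \<noteq> j \<Longrightarrow> D $ i $ j = 0"
    and MS: "M ** S = S ** D"
    and simple: "is_simple_eigenvalue M \<mu>" and i: "D $ i $ i = \<mu>" and j: "D $ j $ j = \<mu>"
  shows "i = j"
proof (rule ccontr)
  assume ne: "i \<noteq> j"
  let ?f = "\<lambda>i. [:- D $ i $ i, 1:]"
  have eq: "charpoly M = prod ?f UNIV"
    by (rule charpoly_eq_prod[OF S D MS])
  have "prod ?f UNIV = ?f i * (?f j * prod ?f (UNIV - {i} - {j}))"
    using ne by (subst prod.remove[of _ i], simp, simp, subst prod.remove[of _ j]) auto
  then have "[:- \<mu>, 1:] ^ 2 dvd charpoly M"
    unfolding eq power2_eq_square by (simp only: i j mult.assoc[symmetric] dvd_triv_left)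
  moreover have "charpoly M \<noteq> 0"
    unfolding eq by simp
  ultimately have "2 \<le> order \<mu> (charpoly M)"
    by (simp add: order_divides)
  then show False
    using simple by (simp add: is_simple_eigenvalue_def)
qed

text \<open>In the coordinates \<open>y\<close> of the eigenbasis the eigenvector equation is
  diagonal, so \<open>y\<close> vanishes wherever the diagonal entry differs from l. This later
  translates orthogonality to \<open>v\<close> into orthogonality to column i of
  \<open>S\<close>.\<close>

lemma eigenvector_column_unique:
  fixes M :: "real^'n^'n" and S D :: "complex^'n^'n"
  assumes S: "invertible S" and D: "\<And>i j. i \<noteq> j \<Longrightarrow> D $ i $ j = 0"
    and MS: "complex_matrix M ** S = S ** D"
    and v: "M *v v = l *\<^sub>R v" "v \<noteq> 0"
    and i: "\<And>j. D $ j $ j = complex_of_real l \<Longrightarrow> j = i"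
  obtains c where "\<And>k. complex_of_real (v $ k) = c * S $ k $ i"
proof -
  obtain S' where S': "S ** S' = mat 1" "S' ** S = mat 1"
    using S unfolding invertible_def by blast
  define x :: "complex^'n" where "x = (\<chi> k. complex_of_real (v $ k))"
  define y where "y = S' *v x"
  have Mx: "complex_matrix M *v x = complex_of_real l *s x"
  proof -
    have "(M *v v) $ k = (l *\<^sub>R v) $ k" for k using v by simp
    then have "complex_of_real ((M *v v) $ k) = complex_of_real ((l *\<^sub>R v) $ k)" for k by simp
    then show ?thesis
      by (simp add: vec_eq_iff x_def complex_matrix_def matrix_vector_mult_def)
  qed
  have x: "S *v y = x"
    unfolding y_def by (simp add: matrix_vector_mul_assoc S')
  have "D *v y = S' *v (S *v (D *v y))"
    by (simp add: matrix_vector_mul_assoc S' matrix_mul_assoc)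
  also have "S *v (D *v y) = complex_matrix M *v (S *v y)"
    by (simp add: matrix_vector_mul_assoc MS)
  also have "\<dots> = complex_of_real l *s x"
    using Mx x by simp
  also have "S' *v (complex_of_real l *s x) = complex_of_real l *s y"
    by (simp add: y_def vector_scalar_commute)
  finally have Dy: "D *v y = complex_of_real l *s y" .
  have "y $ j = 0" if "j \<noteq> i" for j
  proof -
    have "(D *v y) $ j = (\<Sum>k\<in>UNIV. if k = j then D $ j $ j * y $ j else 0)"
      unfolding matrix_vector_mult_def vec_lambda_beta by (rule sum.cong) (auto simp: D)
    then have "D $ j $ j = complex_of_real l \<or> y $ j = 0"
      using Dy by auto
    then show ?thesis
      using i[of j] that by blast
  qed
  then have "x $ k = (\<Sum>j\<in>UNIV. if j = i then y $ i * S $ k $ i else 0)" for k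
    unfolding x[symmetric] matrix_vector_mult_def vec_lambda_beta by (intro sum.cong) auto
  then have "complex_of_real (v $ k) = y $ i * S $ k $ i" for k
    by (simp add: x_def)
  then show thesis by (rule that)
qed

lemma diagonal_entry_is_eigenvalue:
  fixes M S D :: "complex^'n^'n"
  assumes S: "invertible S" and D: "\<And>i j. i \<noteq> j \<Longrightarrow> D $ i $ j = 0"
    and MS: "M ** S = S ** D"
  shows "is_eigenvalue M (D $ i $ i)"
proof -
  have "column i S \<noteq> 0"
  proof
    assume "column i S = 0"
    then have "det S = 0" by (rule det_zero_column(1)[OF _, rotated])
    then show False using S by (simp add: invertible_det_nz)
  qed
  moreover have "M *v column i S = D $ i $ i *s column i S"
  proof -
    have "(M *v column i S) $ k = (M ** S) $ k $ i" for k
      by (simp add: matrix_vector_mult_def matrix_matrix_mult_def column_def)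
    also have "(S ** D) $ k $ i = (\<Sum>j\<in>UNIV. if j = i then S $ k $ i * D $ i $ i else 0)" for k
      unfolding matrix_matrix_mult_def vec_lambda_beta by (rule sum.cong) (auto simp: D)
    ultimately show ?thesis
      by (simp add: vec_eq_iff MS column_def)
  qed
  ultimately show ?thesis unfolding is_eigenvalue_def by blast
qed

text \<open>The eigenvector equation is measured in the l1 norm \<open>s\<close>: every column of
  absolute values sums to at most CARD('n) times m.\<close>

lemma eigenvalue_entry_bound:
  fixes M :: "complex^'n^'n"
  assumes "is_eigenvalue M \<mu>" and M: "\<And>i j. cmod (M $ i $ j) \<le> m"
  shows "cmod \<mu> \<le> real CARD('n) * m"
proof -
  obtain x where x: "x \<noteq> 0" "M *v x = \<mu> *s x"
    using assms(1) unfolding is_eigenvalue_def by blast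
  define s where "s = (\<Sum>j\<in>UNIV. cmod (x $ j))"
  obtain j where "x $ j \<noteq> 0" using x(1) by (auto simp: vec_eq_iff)
  then have "s > 0" unfolding s_def by (intro sum_pos2[of _ j]) auto
  have "cmod \<mu> * s = (\<Sum>i\<in>UNIV. cmod ((M *v x) $ i))"
    by (simp add: x s_def sum_distrib_left norm_mult)
  also have "\<dots> \<le> (\<Sum>i\<in>(UNIV::'n set). \<Sum>j\<in>UNIV. m * cmod (x $ j))"
    unfolding matrix_vector_mult_def
    by (intro sum_mono) (auto intro!: order.trans[OF norm_sum] sum_mono mult_right_mono M simp: norm_mult)
  also have "\<dots> = real CARD('n) * m * s"
    by (simp add: s_def sum_distrib_left mult.assoc)
  finally show ?thesis using \<open>s > 0\<close> by simp
qed

lemma matrix_vector_entry_bound: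
  fixes M :: "real^'n^'m"
  assumes M: "\<And>i j. \<bar>M $ i $ j\<bar> \<le> m"
  shows "norm (M *v x) \<le> real CARD('m) * real CARD('n) * m * norm x"
proof -
  have "norm (M *v x) \<le> (\<Sum>i\<in>UNIV. \<bar>(M *v x) $ i\<bar>)"
    by (rule norm_le_l1_cart)
  also have "\<dots> \<le> (\<Sum>i\<in>(UNIV::'m set). \<Sum>j\<in>(UNIV::'n set). m * norm x)"
    unfolding matrix_vector_mult_def
    using M order.trans[OF abs_ge_zero M]
    by (intro sum_mono) (simp add: abs_mult mult_mono component_le_norm_cart order.trans[OF sum_abs] sum_mono
        del: sum_constant)
  finally show ?thesis by simp
qed


section \<open>A uniform bound for the Lyapunov equation\<close>

lemma norm_diff_square_le:
  fixes u v :: "'a::real_inner"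
  shows "(norm (u - v))\<^sup>2 \<le> 2 * (norm u)\<^sup>2 + 2 * (norm v)\<^sup>2"
proof -
  have "(norm (u - v))\<^sup>2 + (norm (u + v))\<^sup>2 = 2 * (norm u)\<^sup>2 + 2 * (norm v)\<^sup>2"
    by (simp add: power2_norm_eq_inner algebra_simps)
  then show ?thesis using zero_le_power2[of "norm (u + v)"] by linarith
qed

text \<open>These are the constants of the induction over eigenvalue indices: n counts the indices,
  m bounds \<open>M\<close> and the eigenvalues, b bounds \<open>B\<close>, and \<delta> is the gap.
  The summand with b is the noise contribution of one step; the factor of K is the price of passing
  to the image under \<open>M\<close> minus an eigenvalue.\<close>

definition lyapunov_bound :: "real \<Rightarrow> real \<Rightarrow> real \<Rightarrow> nat \<Rightarrow> real" where
  "lyapunov_bound m b \<delta> n = ((\<lambda>K. b\<^sup>2 / \<delta> + 4 * m\<^sup>2 / \<delta>\<^sup>2 * K) ^^ n) 0"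

lemma lyapunov_bound_nonneg: "\<delta> > 0 \<Longrightarrow> 0 \<le> lyapunov_bound m b \<delta> n"
  by (induction n) (simp_all add: lyapunov_bound_def)

text \<open>Testing the Lyapunov equation at \<open>a\<close> on both sides gives two terms that the
  symmetry of \<open>C\<close> makes equal. It serves twice: for the estimate off the critical
  direction, and at the left eigenvector for the exact critical variance.\<close>

lemma lyapunov_form:
  fixes M C :: "real^'n^'n" and B :: "real^'m^'n"
  assumes lyap: "M ** C + C ** transpose M = B ** transpose B" and sym: "transpose C = C"
  shows "2 * (a \<bullet> (C *v (a v* M))) = (norm (a v* B))\<^sup>2"
proof -
  have "a \<bullet> ((M ** C + C ** transpose M) *v a) = a \<bullet> (M *v (C *v a)) + a \<bullet> (C *v (a v* M))"
    by (simp add: matrix_vector_mult_add_rdistrib inner_add_right flip: matrix_vector_mul_assoc)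
  also have "a \<bullet> (M *v (C *v a)) = (a v* M) \<bullet> (C *v a)"
    by (simp add: dot_lmul_matrix)
  also have "\<dots> = ((a v* M) v* C) \<bullet> a"
    by (simp add: dot_lmul_matrix)
  also have "(a v* M) v* C = C *v (a v* M)"
    by (metis sym transpose_matrix_vector)
  finally have "2 * (a \<bullet> (C *v (a v* M))) = a \<bullet> ((B ** transpose B) *v a)"
    by (simp add: lyap inner_commute)
  also have "\<dots> = a \<bullet> (B *v (a v* B))"
    by (simp flip: matrix_vector_mul_assoc)
  also have "\<dots> = (a v* B) \<bullet> (a v* B)"
    by (simp add: dot_lmul_matrix)
  finally show ?thesis by (simp add: power2_norm_eq_inner)
qed

text \<open>The pair \<open>(p, q)\<close> stands for the complex vector \<open>p + i q\<close>, and \<open>J\<close> contains the indices of the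
  left eigenvectors in its expansion.  Applying \<open>M\<^sup>T - \<mu>\<close> for an eigenvalue \<open>\<mu>\<close> removes one index
  from \<open>J\<close>; the Lyapunov equation controls the form at \<open>p + i q\<close> by the form at the image, with
  constants that do not depend on how well conditioned the eigenbasis is.\<close>

lemma lyapunov_form_bound:
  fixes M C :: "real^'n^'n" and B :: "real^'m^'n" and S D :: "complex^'n^'n"
  assumes lyap: "M ** C + C ** transpose M = B ** transpose B" and sym: "transpose C = C"
    and psd: "\<And>u. 0 \<le> u \<bullet> (C *v u)" and \<delta>: "\<delta> > 0"
    and S: "invertible S" and D: "\<And>i j. i \<noteq> j \<Longrightarrow> D $ i $ j = 0"
    and MS: "complex_matrix M ** S = S ** D"
    and M: "\<And>a. norm (a v* M) \<le> m * norm a" and B: "\<And>a. norm (a v* B) \<le> b * norm a"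
    and J: "\<And>i. i \<in> J \<Longrightarrow> \<delta> \<le> Re (D $ i $ i) \<and> cmod (D $ i $ i) \<le> m"
    and supp: "\<And>i. i \<notin> J \<Longrightarrow> (\<Sum>k\<in>UNIV. S $ k $ i * Complex (p $ k) (q $ k)) = 0"
  shows "p \<bullet> (C *v p) + q \<bullet> (C *v q) \<le> lyapunov_bound m b \<delta> (card J) * ((norm p)\<^sup>2 + (norm q)\<^sup>2)"
  using finite[of J] J supp
proof (induction J arbitrary: p q rule: finite_induct)
  case empty
  define x :: "complex^'n" where "x = (\<chi> k. Complex (p $ k) (q $ k))"
  \<comment> \<open>With no index left, p + i q pairs to zero with every column of the invertible
    \<open>S\<close>, hence vanishes.\<close>
  have "transpose S *v x = 0"
    using empty(2) by (simp add: vec_eq_iff vector_matrix_mult_def x_def mult.commute)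
  moreover obtain S' where "S ** S' = mat 1"
    using S unfolding invertible_def by blast
  then have "transpose S' ** transpose S = mat 1"
    by (metis matrix_transpose_mul transpose_mat)
  ultimately have "x = 0"
    by (metis matrix_vector_mul_assoc matrix_vector_mul_lid matrix_vector_mult_0_right)
  then have "p = 0 \<and> q = 0"
    by (simp add: x_def vec_eq_iff complex_eq_iff)
  then show ?case by simp
next
  case (insert j J)
  let ?K = "lyapunov_bound m b \<delta> (card J)"
  let ?Q = "\<lambda>p q. p \<bullet> (C *v p) + q \<bullet> (C *v q)"
  let ?N = "\<lambda>p q :: real^'n. (norm p)\<^sup>2 + (norm q)\<^sup>2"
  define \<mu> where "\<mu> = D $ j $ j"
  define e f where "e = Re \<mu>" and "f = Im \<mu>"
  have e: "\<delta> \<le> e" and \<mu>: "cmod \<mu> \<le> m"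
    using insert.prems(1)[of j] by (auto simp: \<mu>_def e_def)
  \<comment> \<open>\<open>p'\<close> and \<open>q'\<close> are the real and imaginary parts of the
    image of p + i q under the transpose of \<open>M\<close> minus \<mu>.\<close>
  define p' where "p' = p v* M - (e *\<^sub>R p - f *\<^sub>R q)"
  define q' where "q' = q v* M - (e *\<^sub>R q + f *\<^sub>R p)"
  have symC: "u \<bullet> (C *v u') = u' \<bullet> (C *v u)" for u u'
    by (metis dot_lmul_matrix inner_commute sym transpose_matrix_vector)

  \<comment> \<open>The columns of \<open>S\<close> are right eigenvectors, so each pairing is
    multiplied by its eigenvalue minus \<mu>; the factor is zero at index j, which leaves the
    support.\<close>
  have "(\<Sum>k\<in>UNIV. S $ k $ i * Complex (p' $ k) (q' $ k)) =
      (D $ i $ i - \<mu>) * (\<Sum>k\<in>UNIV. S $ k $ i * Complex (p $ k) (q $ k))" for i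
  proof -
    have x': "Complex (p' $ k) (q' $ k) =
        (\<Sum>l\<in>UNIV. complex_of_real (M $ l $ k) * Complex (p $ l) (q $ l)) - \<mu> * Complex (p $ k) (q $ k)" for k
      by (simp add: complex_eq_iff p'_def q'_def e_def f_def vector_matrix_mult_def algebra_simps)
    have "(\<Sum>k\<in>UNIV. S $ k $ i * (\<Sum>l\<in>UNIV. complex_of_real (M $ l $ k) * Complex (p $ l) (q $ l))) =
        (\<Sum>l\<in>UNIV. (complex_matrix M ** S) $ l $ i * Complex (p $ l) (q $ l))"
      unfolding sum_distrib_left matrix_matrix_mult_def vec_lambda_beta sum_distrib_right
      by (subst sum.swap) (simp add: complex_matrix_def ac_simps)
    moreover have "(complex_matrix M ** S) $ l $ i = D $ i $ i * S $ l $ i" for l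
    proof -
      have "(S ** D) $ l $ i = (\<Sum>k\<in>UNIV. if k = i then D $ i $ i * S $ l $ i else 0)"
        unfolding matrix_matrix_mult_def vec_lambda_beta by (rule sum.cong) (auto simp: D)
      then show ?thesis by (simp add: MS)
    qed
    ultimately show ?thesis
      by (simp add: x' algebra_simps sum_subtractf sum_distrib_left)
  qed
  then have supp': "(\<Sum>k\<in>UNIV. S $ k $ i * Complex (p' $ k) (q' $ k)) = 0" if "i \<notin> J" for i
    using insert.prems(2)[of i] that by (cases "i = j") (simp_all add: \<mu>_def)
  have IH: "?Q p' q' \<le> ?K * ?N p' q'"
    using insert.prems(1) supp' by (intro insert.IH) auto

  \<comment> \<open>Both \<open>M\<close> and multiplication by \<mu> enlarge norms by at most m;
    squaring the difference doubles each contribution, whence 2 + 2 = 4.\<close>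
  have N': "?N p' q' \<le> 4 * m\<^sup>2 * ?N p q"
  proof -
    have Msq: "(norm (a v* M))\<^sup>2 \<le> m\<^sup>2 * (norm a)\<^sup>2" for a
      using power_mono[OF M, of a 2] by (simp add: power_mult_distrib)
    have "(norm (e *\<^sub>R p - f *\<^sub>R q))\<^sup>2 + (norm (e *\<^sub>R q + f *\<^sub>R p))\<^sup>2 = (e\<^sup>2 + f\<^sup>2) * ?N p q"
      unfolding power2_norm_eq_inner by (simp add: inner_commute power2_eq_square algebra_simps)
    also have "e\<^sup>2 + f\<^sup>2 = (cmod \<mu>)\<^sup>2" by (simp add: e_def f_def cmod_power2)
    also have "(cmod \<mu>)\<^sup>2 * ?N p q \<le> m\<^sup>2 * ?N p q"
      using \<mu> by (intro mult_right_mono power_mono) auto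
    finally show ?thesis
      using norm_diff_square_le[of "p v* M" "e *\<^sub>R p - f *\<^sub>R q"]
        norm_diff_square_le[of "q v* M" "e *\<^sub>R q + f *\<^sub>R p"] Msq[of p] Msq[of q]
      unfolding p'_def q'_def by (simp add: algebra_simps)
  qed

  have Bsq: "(norm (a v* B))\<^sup>2 \<le> b\<^sup>2 * (norm a)\<^sup>2" for a
    using power_mono[OF B, of a 2] by (simp add: power_mult_distrib)
  \<comment> \<open>The terms with the imaginary part \<open>f\<close> cancel by symmetry of
    \<open>C\<close>. The real part of \<mu> survives with a negative sign, and this is where the
    gap acts.\<close>
  have "2 * (p \<bullet> (C *v p') + q \<bullet> (C *v q')) =
      2 * (p \<bullet> (C *v (p v* M))) + 2 * (q \<bullet> (C *v (q v* M))) - 2 * e * ?Q p q"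
    using symC[of p q] by (simp add: p'_def q'_def algebra_simps inner_diff_right inner_add_right)
  also have "\<dots> \<le> b\<^sup>2 * ?N p q - 2 * e * ?Q p q"
    using Bsq[of p] Bsq[of q] by (simp add: lyapunov_form[OF lyap sym] algebra_simps)
  also have "\<dots> \<le> b\<^sup>2 * ?N p q - 2 * \<delta> * ?Q p q"
    using e psd[of p] psd[of q] mult_right_mono[OF e, of "?Q p q"] by simp
  finally have "\<delta> * (2 * (p \<bullet> (C *v p') + q \<bullet> (C *v q'))) \<le> \<delta> * (b\<^sup>2 * ?N p q - 2 * \<delta> * ?Q p q)"
    using \<delta> by (intro mult_left_mono) auto
  \<comment> \<open>A completed square replaces Cauchy-Schwarz. With weight \<delta> the expansion
    contributes \<delta> squared times the form, against minus twice that amount from the previous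
    estimate, so the form can be solved for.\<close>
  moreover have "0 \<le> ?Q (\<delta> *\<^sub>R p + p') (\<delta> *\<^sub>R q + q')"
    using psd by (intro add_nonneg_nonneg)
  then have "0 \<le> \<delta>\<^sup>2 * ?Q p q + \<delta> * (2 * (p \<bullet> (C *v p') + q \<bullet> (C *v q'))) + ?Q p' q'"
    using symC[of p p'] symC[of q q']
    by (simp add: algebra_simps inner_add_right inner_add_left power2_eq_square)
  ultimately have "\<delta>\<^sup>2 * ?Q p q \<le> \<delta> * b\<^sup>2 * ?N p q + ?Q p' q'"
    by (simp add: algebra_simps power2_eq_square)
  also have "\<dots> \<le> \<delta> * b\<^sup>2 * ?N p q + ?K * (4 * m\<^sup>2 * ?N p q)"
    using IH mult_left_mono[OF N' lyapunov_bound_nonneg[OF \<delta>, of m b "card J"]] by linarith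
  finally have "?Q p q \<le> (\<delta> * b\<^sup>2 * ?N p q + ?K * (4 * m\<^sup>2 * ?N p q)) / \<delta>\<^sup>2"
    using \<delta> by (simp add: pos_le_divide_eq mult.commute)
  also have "\<dots> = lyapunov_bound m b \<delta> (card (insert j J)) * ?N p q"
    using insert.hyps \<delta> by (simp add: lyapunov_bound_def field_simps power2_eq_square)
  finally show ?case .
qed

text \<open>Orthogonality to \<open>v\<close> removes the critical index from the expansion of
  \<open>a\<close>, so the induction meets only the other CARD('n) - 1 eigenvalues, all beyond the
  gap. The eigenvalue l does not enter the constant, which therefore survives the limit l to
  0.\<close>

lemma complementary_covariance_bound:
  fixes M C :: "real^'n^'n" and B :: "real^'m^'n"
  assumes lyap: "M ** C + C ** transpose M = B ** transpose B" and sym: "transpose C = C"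
    and psd: "\<And>u. 0 \<le> u \<bullet> (C *v u)" and \<delta>: "\<delta> > 0"
    and diag: "is_diagonalizable (complex_matrix M)"
    and simple: "is_simple_eigenvalue (complex_matrix M) (complex_of_real l)"
    and gap: "\<And>\<mu>. is_eigenvalue (complex_matrix M) \<mu> \<Longrightarrow> \<mu> \<noteq> complex_of_real l \<Longrightarrow> \<delta> \<le> Re \<mu>"
    and v: "M *v v = l *\<^sub>R v" "v \<noteq> 0" and a: "a \<bullet> v = 0"
    and M: "\<And>i j. \<bar>M $ i $ j\<bar> \<le> m" and B: "\<And>a. norm (a v* B) \<le> b * norm a"
  shows "a \<bullet> (C *v a) \<le> lyapunov_bound ((real CARD('n))\<^sup>2 * m) b \<delta> (CARD('n) - 1) * (norm a)\<^sup>2"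
proof -
  \<comment> \<open>The square of the dimension comes from the crude operator bound for a matrix
    with entries at most m; it also dominates the eigenvalue bound.\<close>
  let ?m = "(real CARD('n))\<^sup>2 * m"
  obtain S D :: "complex^'n^'n" where S: "invertible S" and D: "\<And>i j. i \<noteq> j \<Longrightarrow> D $ i $ j = 0"
    and MS: "complex_matrix M ** S = S ** D"
    using is_diagonalizable_intertwines[OF diag] by blast
  obtain i where i: "D $ i $ i = complex_of_real l"
  proof -
    have "poly (charpoly (complex_matrix M)) (complex_of_real l) = 0"
      using simple by (metis is_simple_eigenvalue_def order_root zero_neq_one)
    then show thesis
      using that by (auto simp: charpoly_eq_prod[OF S D MS] poly_prod)
  qed
  have uniq: "k = i" if "D $ k $ k = complex_of_real l" for k
    using simple_eigenvalue_diagonal_unique[OF S D MS simple that i] .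
  obtain c where c: "\<And>k. complex_of_real (v $ k) = c * S $ k $ i"
    using eigenvector_column_unique[OF S D MS v uniq] by blast
  have m: "0 \<le> m" using order.trans[OF abs_ge_zero M] .
  have "norm (x v* M) \<le> ?m * norm x" for x
    using matrix_vector_entry_bound[of "transpose M" m x] M
    by (simp add: transpose_def power2_eq_square flip: transpose_matrix_vector)
  moreover have "\<delta> \<le> Re (D $ j $ j) \<and> cmod (D $ j $ j) \<le> ?m" if "j \<in> - {i}" for j
  proof -
    have ev: "is_eigenvalue (complex_matrix M) (D $ j $ j)"
      by (rule diagonal_entry_is_eigenvalue[OF S D MS])
    have "cmod (D $ j $ j) \<le> real CARD('n) * m"
      using M by (intro eigenvalue_entry_bound[OF ev]) (simp add: complex_matrix_def)
    also have "\<dots> \<le> ?m"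
      using m by (intro mult_right_mono) (simp_all add: power2_eq_square Suc_leI)
    finally show ?thesis
      using gap[OF ev] uniq[of j] that by auto
  qed
  \<comment> \<open>The real vector \<open>a\<close> enters with imaginary part 0. Column i is
    proportional to \<open>v\<close> with nonzero factor, so its pairing with \<open>a\<close>
    vanishes.\<close>
  moreover have "(\<Sum>k\<in>UNIV. S $ k $ j * Complex (a $ k) ((0::real^'n) $ k)) = 0" if "j \<notin> - {i}" for j
  proof -
    have "c * (\<Sum>k\<in>UNIV. S $ k $ i * complex_of_real (a $ k)) = complex_of_real (a \<bullet> v)"
      by (simp add: inner_vec_def c sum_distrib_left ac_simps)
    moreover have "c \<noteq> 0"
      using c v(2) by (auto simp: vec_eq_iff)
    ultimately show ?thesis
      using that a by (simp add: Complex_eq)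
  qed
  ultimately have "a \<bullet> (C *v a) + 0 \<bullet> (C *v 0) \<le> lyapunov_bound ?m b \<delta> (card (- {i})) * ((norm a)\<^sup>2 + (norm (0::real^'n))\<^sup>2)"
    by (intro lyapunov_form_bound[OF lyap sym psd \<delta> S D MS _ B])
  then show ?thesis
    by (simp add: Compl_eq_Diff_UNIV card_Diff_singleton)
qed


section \<open>Statistics of degree zero under a dominant Gaussian direction\<close>

lemma gaussian_second_moment:
  fixes X :: "'w \<Rightarrow> real^'n"
  assumes "gaussian_vector \<Omega> X 0 S"
  shows "has_bochner_integral \<Omega> (\<lambda>\<omega>. (u \<bullet> X \<omega>)\<^sup>2) (u \<bullet> (S *v u))"
proof -
  define s where "s = u \<bullet> (S *v u)"
  have X [measurable]: "X \<in> borel_measurable \<Omega>" and s: "s \<ge> 0"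
    and law: "distr \<Omega> borel (\<lambda>\<omega>. u \<bullet> X \<omega>) = normal_law 0 s"
    using assms by (auto simp: gaussian_vector_def s_def)
  have "has_bochner_integral (normal_law 0 s) (\<lambda>x. x\<^sup>2) s"
  proof (cases "s = 0")
    case True
    interpret prob_space "return borel (0::real)"
      by (rule prob_space_return) simp
    have "AE x in return borel 0. x\<^sup>2 = (0::real)"
      by (subst AE_return) auto
    then have "has_bochner_integral (return borel 0) (\<lambda>x. x\<^sup>2) (0::real)"
      by (subst has_bochner_integral_cong_AE[of _ _ "\<lambda>_. 0"]) auto
    then show ?thesis using True by (simp add: normal_law_def)
  next
    case False
    then have pos: "sqrt s > 0" using s by simp
    have "has_bochner_integral lborel (\<lambda>x. normal_density 0 (sqrt s) x *\<^sub>R x\<^sup>2) s"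
      using normal_moment_even[OF pos, of 0 1] s by simp
    then show ?thesis
      unfolding normal_law_def using False by (simp add: has_bochner_integral_density)
  qed
  then have "has_bochner_integral \<Omega> (\<lambda>\<omega>. (u \<bullet> X \<omega>)\<^sup>2) s"
    unfolding law[symmetric] by (simp add: has_bochner_integral_iff integrable_distr_eq integral_distr)
  then show ?thesis by (simp add: s_def)
qed

text \<open>The density is at most its value at 0, and the interval has length 2 L. The bound is
  explicit in L so that L may grow with \<tau>; L = 0 shows that 0 carries no mass.\<close>

lemma normal_law_small_ball:
  assumes X [measurable]: "X \<in> borel_measurable \<Omega>"
    and law: "distr \<Omega> borel X = normal_law 0 \<tau>" and \<tau>: "\<tau> > 0" and L: "L \<ge> 0"
  shows "measure \<Omega> {\<omega> \<in> space \<Omega>. \<bar>X \<omega>\<bar> \<le> L} \<le> 2 * L / sqrt (2 * pi * \<tau>)"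
proof -
  have "emeasure \<Omega> {\<omega> \<in> space \<Omega>. \<bar>X \<omega>\<bar> \<le> L} = emeasure (distr \<Omega> borel X) {-L..L}"
    by (subst emeasure_distr) (auto intro!: arg_cong[where f="emeasure \<Omega>"])
  also have "\<dots> = (\<integral>\<^sup>+x. ennreal (normal_density 0 (sqrt \<tau>) x) * indicator {-L..L} x \<partial>lborel)"
    using \<tau> by (simp add: law normal_law_def emeasure_density)
  also have "\<dots> \<le> (\<integral>\<^sup>+x. ennreal (1 / sqrt (2 * pi * \<tau>)) * indicator {-L..L} x \<partial>lborel)"
    using \<tau> by (intro nn_integral_mono mult_right_mono ennreal_leI)
      (auto simp: normal_density_def divide_simps)
  also have "\<dots> = ennreal (1 / sqrt (2 * pi * \<tau>)) * ennreal (2 * L)"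
    using L by (subst nn_integral_cmult_indicator) auto
  also have "\<dots> = ennreal (2 * L / sqrt (2 * pi * \<tau>))"
    using L \<tau> by (subst ennreal_mult[symmetric]) auto
  finally show ?thesis
    using L \<tau> unfolding measure_def by (intro enn2real_leI) auto
qed

text \<open>If the remainder dominates, then either |s| is at most L or the remainder is at least
  \<kappa> L. A union bound combines the small-ball estimate with Markov's inequality.\<close>

lemma dominated_ratio_tendsto_0:
  fixes r :: "'t \<Rightarrow> 'w \<Rightarrow> 'a::euclidean_space"
  assumes ev: "\<forall>\<^sub>F t in F. prob_space (\<Omega> t) \<and> s t \<in> borel_measurable (\<Omega> t) \<and> r t \<in> borel_measurable (\<Omega> t) \<and>
      distr (\<Omega> t) borel (s t) = normal_law 0 (\<tau> t) \<and>
      integrable (\<Omega> t) (\<lambda>\<omega>. (norm (r t \<omega>))\<^sup>2) \<and> (\<integral>\<omega>. (norm (r t \<omega>))\<^sup>2 \<partial>\<Omega> t) \<le> R"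
    and \<tau>: "filterlim \<tau> at_top F" and \<kappa>: "\<kappa> > 0"
  shows "((\<lambda>t. measure (\<Omega> t) {\<omega> \<in> space (\<Omega> t). \<kappa> * \<bar>s t \<omega>\<bar> \<le> norm (r t \<omega>)}) \<longlongrightarrow> 0) F"
proof (rule tendsto_sandwich[OF _ _ tendsto_const])
  show "\<forall>\<^sub>F t in F. 0 \<le> measure (\<Omega> t) {\<omega> \<in> space (\<Omega> t). \<kappa> * \<bar>s t \<omega>\<bar> \<le> norm (r t \<omega>)}"
    by simp
  have "((\<lambda>x. 2 * x powr (1/4) / sqrt (2 * pi * x) + R / (\<kappa> * x powr (1/4))\<^sup>2) \<longlongrightarrow> 0) at_top"
    using \<kappa> by real_asymp
  from filterlim_compose[OF this \<tau>]
  show "((\<lambda>t. 2 * \<tau> t powr (1/4) / sqrt (2 * pi * \<tau> t) + R / (\<kappa> * \<tau> t powr (1/4))\<^sup>2) \<longlongrightarrow> 0) F" .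
  show "\<forall>\<^sub>F t in F. measure (\<Omega> t) {\<omega> \<in> space (\<Omega> t). \<kappa> * \<bar>s t \<omega>\<bar> \<le> norm (r t \<omega>)}
      \<le> 2 * \<tau> t powr (1/4) / sqrt (2 * pi * \<tau> t) + R / (\<kappa> * \<tau> t powr (1/4))\<^sup>2"
    using ev \<tau>[THEN filterlim_at_top_dense[THEN iffD1], rule_format, of 0]
  proof eventually_elim
    case (elim t)
    then interpret prob_space "\<Omega> t" by simp
    \<comment> \<open>L must tend to infinity for Markov's inequality, yet slower than the square
      root of \<tau> for the small-ball bound; the exponent 1/4 lies between 0 and 1/2.\<close>
    define L where "L = \<tau> t powr (1/4)"
    have L: "L > 0" using elim by (simp add: L_def)
    have [measurable]: "s t \<in> borel_measurable (\<Omega> t)" "r t \<in> borel_measurable (\<Omega> t)"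
      using elim by auto
    have "prob {\<omega> \<in> space (\<Omega> t). \<kappa> * \<bar>s t \<omega>\<bar> \<le> norm (r t \<omega>)} \<le>
        prob ({\<omega> \<in> space (\<Omega> t). \<bar>s t \<omega>\<bar> \<le> L} \<union> {\<omega> \<in> space (\<Omega> t). (\<kappa> * L)\<^sup>2 \<le> (norm (r t \<omega>))\<^sup>2})"
    proof (rule finite_measure_mono)
      have "(\<kappa> * L)\<^sup>2 \<le> (norm (r t \<omega>))\<^sup>2" if "\<kappa> * \<bar>s t \<omega>\<bar> \<le> norm (r t \<omega>)" "\<not> \<bar>s t \<omega>\<bar> \<le> L" for \<omega>
      proof (rule power_mono)
        have "\<kappa> * L \<le> \<kappa> * \<bar>s t \<omega>\<bar>" using that \<kappa> by (intro mult_left_mono) auto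
        then show "\<kappa> * L \<le> norm (r t \<omega>)" using that by simp
      qed (use \<kappa> L in auto)
      then show "{\<omega> \<in> space (\<Omega> t). \<kappa> * \<bar>s t \<omega>\<bar> \<le> norm (r t \<omega>)} \<subseteq>
        {\<omega> \<in> space (\<Omega> t). \<bar>s t \<omega>\<bar> \<le> L} \<union> {\<omega> \<in> space (\<Omega> t). (\<kappa> * L)\<^sup>2 \<le> (norm (r t \<omega>))\<^sup>2}"
        by blast
    qed measurable
    also have "\<dots> \<le> prob {\<omega> \<in> space (\<Omega> t). \<bar>s t \<omega>\<bar> \<le> L} + prob {\<omega> \<in> space (\<Omega> t). (\<kappa> * L)\<^sup>2 \<le> (norm (r t \<omega>))\<^sup>2}"
      by (rule measure_Un_le) measurable
    also have "\<dots> \<le> 2 * L / sqrt (2 * pi * \<tau> t) + R / (\<kappa> * L)\<^sup>2"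
    proof (rule add_mono)
      show "prob {\<omega> \<in> space (\<Omega> t). \<bar>s t \<omega>\<bar> \<le> L} \<le> 2 * L / sqrt (2 * pi * \<tau> t)"
        using elim L by (intro normal_law_small_ball) auto
      have "prob {\<omega> \<in> space (\<Omega> t). (\<kappa> * L)\<^sup>2 \<le> (norm (r t \<omega>))\<^sup>2} \<le> (\<integral>\<omega>. (norm (r t \<omega>))\<^sup>2 \<partial>\<Omega> t) / (\<kappa> * L)\<^sup>2"
        using elim L \<kappa> by (intro integral_Markov_inequality_measure[where A="{}"]) auto
      also have "\<dots> \<le> R / (\<kappa> * L)\<^sup>2"
        using elim by (intro divide_right_mono) auto
      finally show "prob {\<omega> \<in> space (\<Omega> t). (\<kappa> * L)\<^sup>2 \<le> (norm (r t \<omega>))\<^sup>2} \<le> R / (\<kappa> * L)\<^sup>2" .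
    qed
    finally show ?case unfolding L_def .
  qed
qed

text \<open>Outside the event that the remainder dominates, division by |s| brings the argument
  close to \<open>vc\<close> or \<open>- vc\<close>, where h is continuous. On that event, which
  contains s = 0, only the bound G is used and the probability is small.\<close>

lemma homogeneous_L2_limit:
  fixes r :: "'t \<Rightarrow> 'w \<Rightarrow> 'a::euclidean_space" and h :: "'a \<Rightarrow> real"
  assumes ev: "\<forall>\<^sub>F t in F. prob_space (\<Omega> t) \<and> s t \<in> borel_measurable (\<Omega> t) \<and> r t \<in> borel_measurable (\<Omega> t)"
    and v: "(v \<longlongrightarrow> vc) F"
    and ratio: "\<And>\<kappa>. \<kappa> > 0 \<Longrightarrow>
      ((\<lambda>t. measure (\<Omega> t) {\<omega> \<in> space (\<Omega> t). \<kappa> * \<bar>s t \<omega>\<bar> \<le> norm (r t \<omega>)}) \<longlongrightarrow> 0) F"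
    and h [measurable]: "h \<in> borel_measurable borel" and G: "\<And>x. \<bar>h x\<bar> \<le> G"
    and cont: "isCont h vc" "isCont h (- vc)"
    and homogeneous: "\<And>c x. c > 0 \<Longrightarrow> h (c *\<^sub>R x) = h x"
  shows "((\<lambda>t. \<integral>\<omega>. (h (s t \<omega> *\<^sub>R v t + r t \<omega>) - (if s t \<omega> > 0 then h vc else h (- vc)))\<^sup>2 \<partial>\<Omega> t) \<longlongrightarrow> 0) F"
    (is "(?I \<longlongrightarrow> 0) F")
proof (rule tendstoI)
  fix \<epsilon> :: real assume \<epsilon>: "\<epsilon> > 0"
  \<comment> \<open>The good event contributes \<epsilon>/4 and the bad one at most \<epsilon>/2,
    which stays strictly below \<epsilon>.\<close>
  define e where "e = sqrt (\<epsilon> / 4)"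
  have e: "e > 0" "e\<^sup>2 = \<epsilon> / 4" using \<epsilon> by (auto simp: e_def)
  obtain d1 where d1: "d1 > 0" "\<And>y. dist y vc < d1 \<Longrightarrow> dist (h y) (h vc) < e"
    using cont(1) e unfolding continuous_at_eps_delta by blast
  obtain d2 where d2: "d2 > 0" "\<And>y. dist y (- vc) < d2 \<Longrightarrow> dist (h y) (h (- vc)) < e"
    using cont(2) e unfolding continuous_at_eps_delta by blast
  \<comment> \<open>One \<kappa> is spent on \<open>v t - vc\<close>, the other on the rescaled
    remainder.\<close>
  define \<kappa> where "\<kappa> = min d1 d2 / 2"
  have \<kappa>: "\<kappa> > 0" "2 * \<kappa> \<le> d1" "2 * \<kappa> \<le> d2" using d1 d2 by (auto simp: \<kappa>_def)
  \<comment> \<open>The summand 1 keeps the denominator positive when G = 0.\<close>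
  have "\<epsilon> / (2 * (4 * G\<^sup>2 + 1)) > 0" using \<epsilon> by (simp add: add_nonneg_pos)
  then have "\<forall>\<^sub>F t in F. measure (\<Omega> t) {\<omega> \<in> space (\<Omega> t). \<kappa> * \<bar>s t \<omega>\<bar> \<le> norm (r t \<omega>)} < \<epsilon> / (2 * (4 * G\<^sup>2 + 1))"
    by (rule order_tendstoD(2)[OF ratio[OF \<kappa>(1)]])
  moreover have "\<forall>\<^sub>F t in F. dist (v t) vc < \<kappa>"
    using v \<kappa>(1) by (rule tendstoD)
  ultimately show "\<forall>\<^sub>F t in F. dist (?I t) 0 < \<epsilon>"
    using ev
  proof eventually_elim
    case (elim t)
    then interpret prob_space "\<Omega> t" by simp
    have [measurable]: "s t \<in> borel_measurable (\<Omega> t)" "r t \<in> borel_measurable (\<Omega> t)"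
      using elim by auto
    define E where "E = {\<omega> \<in> space (\<Omega> t). \<kappa> * \<bar>s t \<omega>\<bar> \<le> norm (r t \<omega>)}"
    have E [measurable]: "E \<in> sets (\<Omega> t)" unfolding E_def by measurable
    let ?D = "\<lambda>\<omega>. h (s t \<omega> *\<^sub>R v t + r t \<omega>) - (if s t \<omega> > 0 then h vc else h (- vc))"
    have close: "\<bar>?D \<omega>\<bar> \<le> e" if "\<omega> \<in> space (\<Omega> t)" "\<omega> \<notin> E" for \<omega>
    proof -
      define \<sigma> where "\<sigma> = sgn (s t \<omega>)"
      have lt: "norm (r t \<omega>) < \<kappa> * \<bar>s t \<omega>\<bar>" using that by (auto simp: E_def)
      then have ne: "s t \<omega> \<noteq> 0" using norm_ge_zero[of "r t \<omega>"] by auto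
      \<comment> \<open>Homogeneity is available only for positive factors, so the argument is
        divided by |s| and the sign stays in \<open>\<sigma>\<close>.\<close>
      define y where "y = \<sigma> *\<^sub>R v t + (1 / \<bar>s t \<omega>\<bar>) *\<^sub>R r t \<omega>"
      have "s t \<omega> *\<^sub>R v t + r t \<omega> = \<bar>s t \<omega>\<bar> *\<^sub>R y"
        using ne by (simp add: y_def \<sigma>_def algebra_simps abs_mult_sgn)
      then have hy: "h (s t \<omega> *\<^sub>R v t + r t \<omega>) = h y"
        using ne homogeneous[of "\<bar>s t \<omega>\<bar>" y] by simp
      have "y - \<sigma> *\<^sub>R vc = \<sigma> *\<^sub>R (v t - vc) + (1 / \<bar>s t \<omega>\<bar>) *\<^sub>R r t \<omega>"
        by (simp add: y_def algebra_simps)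
      then have "norm (y - \<sigma> *\<^sub>R vc) \<le> norm (v t - vc) + norm (r t \<omega>) / \<bar>s t \<omega>\<bar>"
        using norm_triangle_ineq[of "\<sigma> *\<^sub>R (v t - vc)" "(1 / \<bar>s t \<omega>\<bar>) *\<^sub>R r t \<omega>"] ne
        by (simp add: \<sigma>_def abs_sgn_eq)
      also have "\<dots> < \<kappa> + \<kappa>"
        using elim lt ne by (intro add_strict_mono) (auto simp: dist_norm pos_divide_less_eq)
      finally have "dist y (\<sigma> *\<^sub>R vc) < 2 * \<kappa>" by (simp add: dist_norm)
      then show ?thesis
        using d1(2)[of y] d2(2)[of y] \<kappa> ne unfolding hy
        by (cases "s t \<omega> > 0") (auto simp: \<sigma>_def dist_real_def)
    qed
    have G0: "0 \<le> G" using order.trans[OF abs_ge_zero G] .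
    have far: "\<bar>?D \<omega>\<bar> \<le> 2 * G" for \<omega>
      using G[of "s t \<omega> *\<^sub>R v t + r t \<omega>"] G[of vc] G[of "- vc"] by (auto split: if_splits)
    have far': "(?D \<omega>)\<^sup>2 \<le> (2 * G)\<^sup>2" for \<omega>
      using far[of \<omega>] G0 by (subst abs_le_square_iff[symmetric]) auto
    have int: "integrable (\<Omega> t) (\<lambda>\<omega>. (2 * G)\<^sup>2 * indicator E \<omega>)"
      using E by (intro integrable_mult_right integrable_real_indicator) (simp_all add: emeasure_eq_measure)
    have "?I t \<le> (\<integral>\<omega>. e\<^sup>2 + (2 * G)\<^sup>2 * indicator E \<omega> \<partial>\<Omega> t)"
    proof (rule integral_mono)
      show "integrable (\<Omega> t) (\<lambda>\<omega>. (?D \<omega>)\<^sup>2)"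
        using far' by (intro integrable_const_bound[where B="(2 * G)\<^sup>2"] AE_I2)
          (simp_all only: real_norm_def abs_power2, measurable)
      show "(?D \<omega>)\<^sup>2 \<le> e\<^sup>2 + (2 * G)\<^sup>2 * indicator E \<omega>" if "\<omega> \<in> space (\<Omega> t)" for \<omega>
      proof (cases "\<omega> \<in> E")
        case True
        then have ind: "indicator E \<omega> = (1::real)" by simp
        show ?thesis unfolding ind using far'[of \<omega>] zero_le_power2[of e] by linarith
      next
        case False
        then have "(?D \<omega>)\<^sup>2 \<le> e\<^sup>2"
          using close[of \<omega>] that e by (subst abs_le_square_iff[symmetric]) auto
        then show ?thesis using False by simp
      qed
      show "integrable (\<Omega> t) (\<lambda>\<omega>. e\<^sup>2 + (2 * G)\<^sup>2 * indicator E \<omega>)"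
        by (intro Bochner_Integration.integrable_add integrable_const int)
    qed
    also have "\<dots> = \<epsilon> / 4 + (2 * G)\<^sup>2 * prob E"
      using E by (subst Bochner_Integration.integral_add[OF integrable_const int]) (simp add: e prob_space)
    also have "\<dots> \<le> \<epsilon> / 4 + (4 * G\<^sup>2 + 1) * (\<epsilon> / (2 * (4 * G\<^sup>2 + 1)))"
      using elim by (intro add_left_mono mult_mono) (auto simp: E_def)
    also have "\<dots> = 3 / 4 * \<epsilon>"
    proof -
      have "4 * G\<^sup>2 + 1 \<noteq> 0"
        using zero_le_power2[of G] by linarith
      then show ?thesis by (simp add: field_simps)
    qed
    also have "\<dots> < \<epsilon>" using \<epsilon> by simp
    finally show ?case by simp
  qed
qed

text \<open>Both bounds come from the bias-variance identity: the mean square distance to c is the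
  variance plus the squared bias, two nonnegative terms.\<close>

lemma (in prob_space) variance_le_second_moment:
  fixes X :: "'a \<Rightarrow> real"
  assumes X [measurable]: "random_variable borel X" and "integrable M (\<lambda>\<omega>. (X \<omega>)\<^sup>2)"
  shows "variance X \<le> expectation (\<lambda>\<omega>. (X \<omega> - c)\<^sup>2)"
    and "(expectation X - c)\<^sup>2 \<le> expectation (\<lambda>\<omega>. (X \<omega> - c)\<^sup>2)"
proof -
  have int: "integrable M X"
    by (rule square_integrable_imp_integrable[OF assms])
  have "expectation (\<lambda>\<omega>. (X \<omega> - c)\<^sup>2) = expectation (\<lambda>\<omega>. (X \<omega>)\<^sup>2) - 2 * c * expectation X + c\<^sup>2"
    using int assms by (simp add: power2_diff prob_space algebra_simps)
  also have "\<dots> = variance X + (expectation X - c)\<^sup>2"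
    using int assms by (simp add: variance_eq power2_diff prob_space power2_eq_square algebra_simps)
  finally have eq: "expectation (\<lambda>\<omega>. (X \<omega> - c)\<^sup>2) = variance X + (expectation X - c)\<^sup>2" .
  show "variance X \<le> expectation (\<lambda>\<omega>. (X \<omega> - c)\<^sup>2)"
    unfolding eq by simp
  show "(expectation X - c)\<^sup>2 \<le> expectation (\<lambda>\<omega>. (X \<omega> - c)\<^sup>2)"
    unfolding eq using variance_positive[of X] by linarith
qed

text \<open>Equal laws of s and -s give the two signs equal probability. The value 0, which falls
  into the \<open>else\<close> branch, is a null event by the small-ball bound with radius
  0.\<close>

lemma (in prob_space) symmetric_normal_sign_expectation:
  assumes s [measurable]: "random_variable borel s"
    and law: "distr M borel s = normal_law 0 \<tau>" "distr M borel (\<lambda>\<omega>. - s \<omega>) = normal_law 0 \<tau>"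
    and \<tau>: "\<tau> > 0"
  shows "expectation (\<lambda>\<omega>. if s \<omega> > 0 then K else - K :: real) = 0"
proof -
  let ?pos = "{\<omega> \<in> space M. s \<omega> > 0}" and ?neg = "{\<omega> \<in> space M. s \<omega> < 0}"
  have "AE \<omega> in M. s \<omega> \<noteq> 0"
  proof -
    have "prob {\<omega> \<in> space M. \<bar>s \<omega>\<bar> \<le> 0} \<le> 2 * 0 / sqrt (2 * pi * \<tau>)"
      by (rule normal_law_small_ball[OF s law(1) \<tau>]) simp
    then have "prob {\<omega> \<in> space M. s \<omega> = 0} = 0"
      by (simp add: measure_le_0_iff)
    then show ?thesis
      by (subst AE_iff_measurable[OF _ refl]) (simp_all add: emeasure_eq_measure)
  qed
  then have "expectation (\<lambda>\<omega>. if s \<omega> > 0 then K else - K) =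
      expectation (\<lambda>\<omega>. K * indicator ?pos \<omega> - K * indicator ?neg \<omega>)"
    by (intro integral_cong_AE) (auto elim!: eventually_mono simp: indicator_def split: if_splits)
  also have "\<dots> = K * prob ?pos - K * prob ?neg"
    by (subst Bochner_Integration.integral_diff)
      (auto intro!: integrable_mult_right integrable_real_indicator simp: emeasure_eq_measure)
  also have "prob ?pos = measure (distr M borel s) {0<..}"
    by (subst measure_distr) (auto intro!: arg_cong[where f=prob])
  also have "\<dots> = measure (distr M borel (\<lambda>\<omega>. - s \<omega>)) {0<..}"
    by (simp add: law)
  also have "\<dots> = prob ?neg"
    by (subst measure_distr) (auto intro!: arg_cong[where f=prob])
  finally show ?thesis by simp
qed


section \<open>Spatial statistics\<close>

lemma spatial_mean_scaleR: "spatial_mean (c *\<^sub>R x) = c * spatial_mean x"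
  by (simp add: spatial_mean_def sum_distrib_left)

lemma central_moment_scaleR: "central_moment k (c *\<^sub>R x) = c ^ k * central_moment k x"
proof -
  have "((c *\<^sub>R x) $ i - spatial_mean (c *\<^sub>R x)) ^ k = c ^ k * (x $ i - spatial_mean x) ^ k" for i
    by (simp add: spatial_mean_scaleR flip: power_mult_distrib right_diff_distrib)
  then show ?thesis
    by (simp add: central_moment_def sum_distrib_left)
qed

lemma central_moment_minus: "central_moment k (- x) = (- 1) ^ k * central_moment k x"
  using central_moment_scaleR[of k "- 1" x] by simp

lemma central_moment_2_nonneg: "0 \<le> central_moment 2 x"
  by (simp add: central_moment_def sum_nonneg)

lemma continuous_on_central_moment: "continuous_on A (central_moment k)"
  unfolding central_moment_def spatial_mean_def by (intro continuous_intros) auto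

lemma isCont_central_moment: "isCont (central_moment k) x"
  using continuous_on_central_moment[of UNIV k] unfolding continuous_on_eq_continuous_at[OF open_UNIV] by blast

lemma borel_measurable_central_moment [measurable]: "central_moment k \<in> borel_measurable borel"
  by (intro borel_measurable_continuous_onI continuous_on_central_moment)

text \<open>For a unit vector the right-hand side is 1 minus the squared coordinate sum over the
  dimension; thus the assumption on the critical eigenvector says precisely that it is not spatially
  constant.\<close>

lemma central_moment_2_eq:
  fixes x :: "real^'n"
  shows "real CARD('n) * central_moment 2 x = (norm x)\<^sup>2 - (\<Sum>i\<in>UNIV. x $ i)\<^sup>2 / real CARD('n)"
proof -
  let ?s = "\<Sum>i\<in>UNIV. x $ i"
  have norm: "(norm x)\<^sup>2 = (\<Sum>i\<in>UNIV. (x $ i)\<^sup>2)"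
    unfolding power2_norm_eq_inner by (simp add: inner_vec_def power2_eq_square)
  have "real CARD('n) * central_moment 2 x = (\<Sum>i\<in>UNIV. (x $ i)\<^sup>2 - 2 * spatial_mean x * x $ i + (spatial_mean x)\<^sup>2)"
    by (simp add: central_moment_def power2_diff algebra_simps)
  also have "\<dots> = (norm x)\<^sup>2 - 2 * spatial_mean x * ?s + real CARD('n) * (spatial_mean x)\<^sup>2"
    by (simp add: sum.distrib sum_subtractf norm flip: sum_distrib_left)
  also have "\<dots> = (norm x)\<^sup>2 - ?s\<^sup>2 / real CARD('n)"
    by (simp add: spatial_mean_def power2_eq_square)
  finally show ?thesis .
qed

text \<open>This is the source of the boundedness of all three statistics: each deviation is
  controlled by the second moment in the denominator.\<close>

lemma deviation_bound:
  fixes x :: "real^'n"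
  shows "\<bar>x $ i - spatial_mean x\<bar> \<le> sqrt (real CARD('n)) * sqrt (central_moment 2 x)"
proof -
  have "(x $ i - spatial_mean x)\<^sup>2 \<le> (\<Sum>i\<in>UNIV. (x $ i - spatial_mean x)\<^sup>2)"
    by (rule member_le_sum) auto
  also have "\<dots> = real CARD('n) * central_moment 2 x"
    by (simp add: central_moment_def)
  finally show ?thesis
    by (metis real_sqrt_abs real_sqrt_le_iff real_sqrt_mult)
qed

lemma central_moment_bound:
  fixes x :: "real^'n"
  shows "\<bar>central_moment k x\<bar> \<le> sqrt (real CARD('n)) ^ k * sqrt (central_moment 2 x) ^ k"
proof -
  let ?b = "sqrt (real CARD('n)) * sqrt (central_moment 2 x)"
  have "\<bar>\<Sum>i\<in>UNIV. (x $ i - spatial_mean x) ^ k\<bar> \<le> (\<Sum>i\<in>(UNIV::'n set). ?b ^ k)"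
    by (rule order.trans[OF sum_abs], rule sum_mono)
      (simp add: power_abs power_mono deviation_bound del: power_mult_distrib)
  then show ?thesis
    by (simp add: central_moment_def abs_divide divide_le_eq power_mult_distrib mult.commute)
qed

lemma powr_three_halves: "0 \<le> x \<Longrightarrow> x powr (3/2) = sqrt x ^ 3"
  by (simp add: powr_half_sqrt[symmetric] powr_powr flip: powr_numeral[of "x powr (1/2)" "num.Bit1 num.One"])

lemma spatial_skewness_scaleR:
  assumes "c > 0" shows "spatial_skewness (c *\<^sub>R x) = spatial_skewness x"
  using assms central_moment_2_nonneg[of x]
  by (simp add: spatial_skewness_def central_moment_scaleR powr_three_halves real_sqrt_mult power_mult_distrib)

lemma spatial_skewness_minus: "spatial_skewness (- x) = - spatial_skewness x"
  by (simp add: spatial_skewness_def central_moment_minus)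

lemma spatial_skewness_bound:
  fixes x :: "real^'n"
  shows "\<bar>spatial_skewness x\<bar> \<le> sqrt (real CARD('n)) ^ 3"
  using central_moment_bound[of 3 x] central_moment_2_nonneg[of x]
  \<comment> \<open>At a spatially constant vector the quotient is 0 by the division convention;
    elsewhere the denominator is positive.\<close>
  by (cases "central_moment 2 x = 0")
    (auto simp: spatial_skewness_def powr_three_halves abs_divide divide_le_eq)

lemma isCont_spatial_skewness:
  assumes "central_moment 2 x > 0" shows "isCont spatial_skewness x"
  unfolding spatial_skewness_def using assms
  by (intro continuous_intros isCont_central_moment) auto

lemma borel_measurable_spatial_skewness [measurable]: "spatial_skewness \<in> borel_measurable borel"
  unfolding spatial_skewness_def by measurable

lemma spatial_kurtosis_scaleR:
  assumes "c \<noteq> 0" shows "spatial_kurtosis (c *\<^sub>R x) = spatial_kurtosis x"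
  using assms by (simp add: spatial_kurtosis_def central_moment_scaleR power_mult_distrib flip: power_mult)

lemma spatial_kurtosis_bound:
  fixes x :: "real^'n"
  shows "\<bar>spatial_kurtosis x\<bar> \<le> (real CARD('n))\<^sup>2"
proof -
  have "sqrt a ^ 4 = a\<^sup>2" if "a \<ge> 0" for a
    using that power_mult[of "sqrt a" 2 2] by simp
  then show ?thesis
    using central_moment_bound[of 4 x] central_moment_2_nonneg[of x]
    by (cases "central_moment 2 x = 0")
      (auto simp: spatial_kurtosis_def abs_divide divide_le_eq)
qed

lemma isCont_spatial_kurtosis:
  assumes "central_moment 2 x > 0" shows "isCont spatial_kurtosis x"
  unfolding spatial_kurtosis_def using assms
  by (intro continuous_intros isCont_central_moment) auto

lemma borel_measurable_spatial_kurtosis [measurable]: "spatial_kurtosis \<in> borel_measurable borel"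
  unfolding spatial_kurtosis_def by measurable

lemma sum_squares_eq_central_moment:
  fixes x :: "real^'n"
  shows "(\<Sum>i\<in>UNIV. (x $ i - spatial_mean x)\<^sup>2) = real CARD('n) * central_moment 2 x"
  by (simp add: central_moment_def)

lemma moran_I_scaleR:
  assumes "c \<noteq> 0" shows "moran_I A (c *\<^sub>R x) = moran_I A x"
proof -
  have dev: "(c *\<^sub>R x) $ i - spatial_mean (c *\<^sub>R x) = c * (x $ i - spatial_mean x)" for i
    by (simp add: spatial_mean_scaleR algebra_simps)
  have "(\<Sum>i\<in>UNIV. \<Sum>j\<in>UNIV. A $ i $ j * (c * (x $ i - spatial_mean x)) * (c * (x $ j - spatial_mean x))) =
      c\<^sup>2 * (\<Sum>i\<in>UNIV. \<Sum>j\<in>UNIV. A $ i $ j * (x $ i - spatial_mean x) * (x $ j - spatial_mean x))"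
    by (simp add: sum_distrib_left power2_eq_square ac_simps)
  moreover have "(\<Sum>i\<in>UNIV. (c * (x $ i - spatial_mean x))\<^sup>2) = c\<^sup>2 * (\<Sum>i\<in>UNIV. (x $ i - spatial_mean x)\<^sup>2)"
    by (simp add: sum_distrib_left power_mult_distrib)
  ultimately show ?thesis
    using assms unfolding moran_I_def dev by simp
qed

text \<open>Each product of two deviations is at most the sum of squares in the denominator. The
  weights may have either sign, hence their absolute values.\<close>

lemma moran_I_bound:
  fixes x :: "real^'n"
  shows "\<bar>moran_I A x\<bar> \<le> \<bar>real CARD('n) / total_weight A\<bar> * (\<Sum>i\<in>UNIV. \<Sum>j\<in>UNIV. \<bar>A $ i $ j\<bar>)"
proof -
  let ?d = "\<lambda>i. x $ i - spatial_mean x"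
  let ?s = "\<Sum>i\<in>UNIV. (?d i)\<^sup>2"
  let ?q = "\<Sum>i\<in>UNIV. \<Sum>j\<in>UNIV. A $ i $ j * ?d i * ?d j"
  have quotient: "\<bar>q / t\<bar> \<le> S" if "\<bar>q\<bar> \<le> S * t" "t \<ge> 0" "S \<ge> 0" for q t S :: real
    using that by (cases "t = 0") (auto simp: abs_divide divide_le_eq)
  have s: "?s \<ge> 0" by (simp add: sum_nonneg)
  have dd: "\<bar>?d i * ?d j\<bar> \<le> ?s" for i j
  proof -
    have "\<bar>?d i\<bar> \<le> sqrt ?s" for i
      using deviation_bound[of x i] by (simp add: sum_squares_eq_central_moment real_sqrt_mult)
    then have "\<bar>?d i\<bar> * \<bar>?d j\<bar> \<le> sqrt ?s * sqrt ?s"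
      by (intro mult_mono) (use s in auto)
    then show ?thesis using s by (simp add: abs_mult)
  qed
  have "\<bar>?q\<bar> \<le> (\<Sum>i\<in>UNIV. \<Sum>j\<in>UNIV. \<bar>A $ i $ j\<bar> * ?s)"
    by (intro order.trans[OF sum_abs] sum_mono)
      (simp only: abs_mult mult.assoc mult_left_mono dd[unfolded abs_mult] abs_ge_zero)
  also have "\<dots> = (\<Sum>i\<in>UNIV. \<Sum>j\<in>UNIV. \<bar>A $ i $ j\<bar>) * ?s"
    by (simp add: sum_distrib_right)
  finally have "\<bar>?q / ?s\<bar> \<le> (\<Sum>i\<in>UNIV. \<Sum>j\<in>UNIV. \<bar>A $ i $ j\<bar>)"
    by (rule quotient[OF _ s]) (simp add: sum_nonneg)
  then show ?thesis
    unfolding moran_I_def abs_mult[of "_ / total_weight A"] by (intro mult_left_mono) auto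
qed

lemma isCont_moran_I:
  fixes x :: "real^'n"
  shows "central_moment 2 x > 0 \<Longrightarrow> isCont (moran_I A) x"
  unfolding moran_I_def sum_squares_eq_central_moment unfolding spatial_mean_def
  by (intro continuous_intros isCont_central_moment) auto

text \<open>Continuity is established only off the spatially constant vectors, so measurability is
  obtained for numerator and denominator separately.\<close>

lemma borel_measurable_moran_I [measurable]: "moran_I A \<in> borel_measurable borel"
proof -
  have "(\<lambda>x. \<Sum>i\<in>UNIV. \<Sum>j\<in>UNIV. A $ i $ j * (x $ i - spatial_mean x) * (x $ j - spatial_mean x)) \<in> borel_measurable borel"
    unfolding spatial_mean_def by (intro borel_measurable_continuous_onI continuous_intros) auto
  then show ?thesis
    unfolding moran_I_def sum_squares_eq_central_moment by measurable
qed

lemma centering_matrix_mult: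
  fixes x :: "real^'n"
  shows "(centering_matrix *v x) $ i = x $ i - spatial_mean x"
  by (simp add: centering_matrix_def matrix_vector_mult_diff_rdistrib)
    (simp add: matrix_vector_mult_def spatial_mean_def sum_divide_distrib)

lemma transpose_centering_matrix: "transpose centering_matrix = centering_matrix"
  by (simp add: centering_matrix_def transpose_def mat_def vec_eq_iff)

text \<open>The centering matrix is symmetric and idempotent, so both sums of deviations are
  quadratic forms in \<open>x\<close>.\<close>

lemma moran_I_eq_quadratic_forms:
  fixes x :: "real^'n"
  shows "moran_I A x = real CARD('n) / total_weight A *
    ((x \<bullet> ((centering_matrix ** A ** centering_matrix) *v x)) / (x \<bullet> (centering_matrix *v x)))"
proof -
  let ?P = "centering_matrix :: real^'n^'n"
  define d where "d = ?P *v x"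
  have d: "d $ i = x $ i - spatial_mean x" for i
    by (simp add: d_def centering_matrix_mult)
  have xP: "x \<bullet> (?P *v y) = d \<bullet> y" for y
    unfolding d_def by (metis dot_lmul_matrix transpose_centering_matrix transpose_matrix_vector)
  have Pd: "?P *v d = d"
  proof -
    have "spatial_mean d = 0"
      by (simp add: d_def spatial_mean_def centering_matrix_mult sum_subtractf)
    then show ?thesis by (simp add: vec_eq_iff centering_matrix_mult)
  qed
  have "x \<bullet> ((?P ** A ** ?P) *v x) = d \<bullet> (A *v d)"
    by (simp add: xP d_def flip: matrix_vector_mul_assoc)
  also have "\<dots> = (\<Sum>i\<in>UNIV. \<Sum>j\<in>UNIV. A $ i $ j * (x $ i - spatial_mean x) * (x $ j - spatial_mean x))"
    by (simp add: inner_vec_def matrix_vector_mult_def sum_distrib_left mult.assoc mult.left_commute flip: d)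
  finally have num: "x \<bullet> ((?P ** A ** ?P) *v x) =
      (\<Sum>i\<in>UNIV. \<Sum>j\<in>UNIV. A $ i $ j * (x $ i - spatial_mean x) * (x $ j - spatial_mean x))" .
  have den: "x \<bullet> (?P *v x) = (\<Sum>i\<in>UNIV. (x $ i - spatial_mean x)\<^sup>2)"
  proof -
    have "x \<bullet> (?P *v x) = x \<bullet> (?P *v d)" by (simp add: Pd) (simp add: d_def)
    also have "\<dots> = d \<bullet> d" by (rule xP)
    finally show ?thesis
      by (simp add: inner_vec_def power2_eq_square d)
  qed
  show ?thesis by (simp only: moran_I_def num den)
qed


section \<open>Approaching the critical parameter\<close>

lemma C2_on_isCont_derivative:
  assumes "C2_on f U" "p \<in> U"
  obtains f1 where "\<And>q. q \<in> U \<Longrightarrow> (f has_derivative blinfun_apply (f1 q)) (at q)" "isCont f1 p"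
  using assms unfolding C2_on_def by (metis has_derivative_continuous)

text \<open>The derivative in x alone is the joint derivative restricted to increments (h, 0); an
  entry is one component of its value at a vector of norm 1.\<close>

lemma jacobian_entry_bound:
  fixes F :: "real^'n \<Rightarrow> real \<Rightarrow> real^'n"
  assumes "((\<lambda>(x, \<alpha>). F x \<alpha>) has_derivative blinfun_apply f') (at (x, \<alpha>))"
  shows "\<bar>jacobian (\<lambda>x. F x \<alpha>) (at x) $ i $ j\<bar> \<le> norm f'"
proof -
  have "((\<lambda>x. (x, \<alpha>)) has_derivative (\<lambda>h. (h, 0))) (at x)"
    by (auto intro!: derivative_eq_intros)
  from has_derivative_compose[OF this, of "\<lambda>(x, \<alpha>). F x \<alpha>" "blinfun_apply f'"] assms
  have "((\<lambda>x. F x \<alpha>) has_derivative (\<lambda>h. f' (h, 0))) (at x)"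
    by simp
  then have "frechet_derivative (\<lambda>x. F x \<alpha>) (at x) = (\<lambda>h. f' (h, 0))"
    by (metis frechet_derivative_at)
  then have "jacobian (\<lambda>x. F x \<alpha>) (at x) $ i $ j = f' (axis j 1, 0) $ i"
    by (simp add: jacobian_def matrix_def)
  also have "\<bar>\<dots>\<bar> \<le> norm (f' (axis j 1, 0))"
    by (rule component_le_norm_cart)
  also have "\<dots> \<le> norm f' * norm (axis j (1::real), 0::real)"
    by (rule norm_blinfun)
  finally show ?thesis by simp
qed

text \<open>The branch together with its parameter converges to a point of \<open>U\<close>, where
  the joint derivative is continuous; its norm is eventually below the limiting norm plus 1.\<close>

lemma jacobian_bounded_along_branch:
  fixes F :: "real^'n \<Rightarrow> real \<Rightarrow> real^'n"
  assumes "C2_on (\<lambda>(x, \<alpha>). F x \<alpha>) U" "(xc, \<alpha>c) \<in> U"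
    and "\<forall>\<^sub>F \<alpha> in at_left \<alpha>c. (xs \<alpha>, \<alpha>) \<in> U" and "(xs \<longlongrightarrow> xc) (at_left \<alpha>c)"
  obtains m where "\<forall>\<^sub>F \<alpha> in at_left \<alpha>c. \<forall>i j. \<bar>jacobian (\<lambda>x. F x \<alpha>) (at (xs \<alpha>)) $ i $ j\<bar> \<le> m"
proof -
  obtain f1 where f1: "\<And>q. q \<in> U \<Longrightarrow> ((\<lambda>(x, \<alpha>). F x \<alpha>) has_derivative blinfun_apply (f1 q)) (at q)"
    and cont: "isCont f1 (xc, \<alpha>c)"
    using C2_on_isCont_derivative[OF assms(1,2)] by blast
  have "((\<lambda>\<alpha>. (xs \<alpha>, \<alpha>)) \<longlongrightarrow> (xc, \<alpha>c)) (at_left \<alpha>c)"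
    using assms(4) by (intro tendsto_Pair tendsto_ident_at)
  then have "((\<lambda>\<alpha>. norm (f1 (xs \<alpha>, \<alpha>))) \<longlongrightarrow> norm (f1 (xc, \<alpha>c))) (at_left \<alpha>c)"
    by (intro tendsto_norm isCont_tendsto_compose[OF cont])
  then have "\<forall>\<^sub>F \<alpha> in at_left \<alpha>c. norm (f1 (xs \<alpha>, \<alpha>)) < norm (f1 (xc, \<alpha>c)) + 1"
    by (rule order_tendstoD) simp
  then have "\<forall>\<^sub>F \<alpha> in at_left \<alpha>c. \<forall>i j. \<bar>jacobian (\<lambda>x. F x \<alpha>) (at (xs \<alpha>)) $ i $ j\<bar> \<le> norm (f1 (xc, \<alpha>c)) + 1"
    using assms(3)
  proof eventually_elim
    case (elim \<alpha>)
    then show ?case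
      using jacobian_entry_bound[OF f1[OF elim(2)]] by (meson less_imp_le order.trans)
  qed
  then show thesis by (rule that)
qed

text \<open>At a left eigenvector the tested Lyapunov equation is a scalar identity, solvable for
  the variance. The numerator has a positive limit, so the divergence of
  \<open>inverse (l \<alpha>)\<close> is inherited.\<close>

lemma critical_variance_at_top:
  fixes B :: "real^'m^'n" and M C :: "real \<Rightarrow> real^'n^'n"
  assumes lyap: "\<forall>\<^sub>F \<alpha> in G. M \<alpha> ** C \<alpha> + C \<alpha> ** transpose (M \<alpha>) = B ** transpose B"
    and sym: "\<forall>\<^sub>F \<alpha> in G. transpose (C \<alpha>) = C \<alpha>"
    and w: "\<forall>\<^sub>F \<alpha> in G. w \<alpha> v* M \<alpha> = l \<alpha> *\<^sub>R w \<alpha>" "(w \<longlongrightarrow> wc) G"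
    and l: "\<forall>\<^sub>F \<alpha> in G. l \<alpha> > 0" "(l \<longlongrightarrow> 0) G"
    and pos: "wc \<bullet> ((B ** transpose B) *v wc) > 0"
  shows "filterlim (\<lambda>\<alpha>. w \<alpha> \<bullet> (C \<alpha> *v w \<alpha>)) at_top G"
proof -
  let ?q = "\<lambda>w. w \<bullet> ((B ** transpose B) *v w)"
  have q: "?q u = (norm (u v* B))\<^sup>2" for u
    by (simp add: dot_lmul_matrix[symmetric] power2_norm_eq_inner flip: matrix_vector_mul_assoc)
  have "((\<lambda>\<alpha>. ?q (w \<alpha>) / 2) \<longlongrightarrow> ?q wc / 2) G"
    by (intro tendsto_intros w bounded_linear.tendsto[OF matrix_vector_mul_bounded_linear]) auto
  moreover have "filterlim (\<lambda>\<alpha>. inverse (l \<alpha>)) at_top G"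
    using l by (intro filterlim_inverse_at_top)
  ultimately have "filterlim (\<lambda>\<alpha>. ?q (w \<alpha>) / 2 * inverse (l \<alpha>)) at_top G"
    using pos by (intro filterlim_tendsto_pos_mult_at_top[of _ "?q wc / 2"]) auto
  moreover have "\<forall>\<^sub>F \<alpha> in G. ?q (w \<alpha>) / 2 * inverse (l \<alpha>) = w \<alpha> \<bullet> (C \<alpha> *v w \<alpha>)"
    using lyap sym w(1) l(1)
  proof eventually_elim
    case (elim \<alpha>)
    have "2 * (w \<alpha> \<bullet> (C \<alpha> *v (w \<alpha> v* M \<alpha>))) = ?q (w \<alpha>)"
      unfolding q by (rule lyapunov_form[OF elim(1,2)])
    then have "?q (w \<alpha>) = 2 * l \<alpha> * (w \<alpha> \<bullet> (C \<alpha> *v w \<alpha>))"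
      using elim(3) by (simp add: matrix_vector_mult_scaleR)
    then show ?case using elim(4) by (simp add: field_simps)
  qed
  ultimately show ?thesis
    by (rule filterlim_mono_eventually[OF _ order_refl order_refl])
qed

text \<open>The map sending z to z minus (w . z) v is an oblique projection that kills
  \<open>v\<close>. Each of its coordinates is thus a linear functional to which the complementary
  variance bound applies.\<close>

lemma gaussian_remainder_bound:
  fixes z :: "'w \<Rightarrow> real^'n"
  assumes gaussian: "gaussian_vector \<Omega> z 0 C"
    and K: "\<And>a. a \<bullet> v = 0 \<Longrightarrow> a \<bullet> (C *v a) \<le> K * (norm a)\<^sup>2" "K \<ge> 0"
    and v: "norm v = 1" "w \<bullet> v = 1"
  shows "integrable \<Omega> (\<lambda>\<omega>. (norm (x + z \<omega> - (w \<bullet> z \<omega>) *\<^sub>R v))\<^sup>2)" (is "integrable _ ?f")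
    and "(\<integral>\<omega>. (norm (x + z \<omega> - (w \<bullet> z \<omega>) *\<^sub>R v))\<^sup>2 \<partial>\<Omega>) \<le>
      2 * (norm x)\<^sup>2 + 2 * real CARD('n) * K * (1 + norm w)\<^sup>2"
proof -
  interpret prob_space \<Omega> using gaussian by (simp add: gaussian_vector_def)
  have [measurable]: "z \<in> borel_measurable \<Omega>" using gaussian by (simp add: gaussian_vector_def)
  \<comment> \<open>\<open>a i\<close> is row i of that projection; the normalization
    \<open>w \<bullet> v = 1\<close> makes it orthogonal to \<open>v\<close>.\<close>
  define a where "a i = axis i 1 - (v $ i) *\<^sub>R w" for i
  have av: "a i \<bullet> v = 0" for i
    using v by (simp add: a_def inner_diff_left inner_axis')
  have na: "norm (a i) \<le> 1 + norm w" for i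
  proof -
    have "norm (a i) \<le> norm (axis i (1::real)) + \<bar>v $ i\<bar> * norm w"
      unfolding a_def by (rule order.trans[OF norm_triangle_ineq4]) simp
    also have "\<dots> \<le> 1 + 1 * norm w"
      using component_le_norm_cart[of v i] v by (intro add_mono mult_right_mono) auto
    finally show ?thesis by simp
  qed
  let ?g = "\<lambda>\<omega>. 2 * (norm x)\<^sup>2 + 2 * (\<Sum>i\<in>UNIV. (a i \<bullet> z \<omega>)\<^sup>2)"
  have moment: "integrable \<Omega> (\<lambda>\<omega>. (a i \<bullet> z \<omega>)\<^sup>2)" "expectation (\<lambda>\<omega>. (a i \<bullet> z \<omega>)\<^sup>2) = a i \<bullet> (C *v a i)" for i
    using gaussian_second_moment[OF gaussian, of "a i"] by (auto simp: has_bochner_integral_iff)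
  have g: "integrable \<Omega> ?g"
    using moment by auto
  have le: "?f \<omega> \<le> ?g \<omega>" for \<omega>
  proof -
    let ?y = "z \<omega> - (w \<bullet> z \<omega>) *\<^sub>R v"
    have "?f \<omega> \<le> 2 * (norm x)\<^sup>2 + 2 * (norm ?y)\<^sup>2"
      using norm_diff_square_le[of x "- ?y"] by (simp add: algebra_simps norm_minus_commute)
    moreover have "?y $ i = a i \<bullet> z \<omega>" for i
      by (simp add: a_def inner_diff_left inner_axis')
    then have "(norm ?y)\<^sup>2 = (\<Sum>i\<in>UNIV. (a i \<bullet> z \<omega>)\<^sup>2)"
      unfolding power2_norm_eq_inner inner_vec_def by (simp add: power2_eq_square)
    ultimately show ?thesis by simp
  qed
  show f: "integrable \<Omega> ?f"
    using le by (intro Bochner_Integration.integrable_bound[OF g] AE_I2)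
      (auto simp: abs_of_nonneg sum_nonneg)
  have "expectation ?f \<le> expectation ?g"
    using f g le by (intro integral_mono)
  also have "\<dots> = 2 * (norm x)\<^sup>2 + 2 * (\<Sum>i\<in>UNIV. a i \<bullet> (C *v a i))"
    using moment by (simp add: prob_space)
  also have "\<dots> \<le> 2 * (norm x)\<^sup>2 + 2 * (\<Sum>i\<in>(UNIV::'n set). K * (1 + norm w)\<^sup>2)"
    using K(2) na by (intro add_left_mono mult_left_mono sum_mono order.trans[OF K(1)[OF av]] power_mono) auto
  finally show "expectation ?f \<le> 2 * (norm x)\<^sup>2 + 2 * real CARD('n) * K * (1 + norm w)\<^sup>2"
    by simp
qed


theorem theorem6p2:
  fixes F :: "real^'n \<Rightarrow> real \<Rightarrow> real^'n"
    and B :: "real^'m^'n"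
    and A :: "real^'n^'n"
    and U :: "((real^'n) \<times> real) set"
    and \<alpha>0 \<alpha>c \<delta> :: real
    and xs :: "real \<Rightarrow> real^'n"
    and xc vc wc :: "real^'n"
    and M C :: "real \<Rightarrow> real^'n^'n"
    and lam1 :: "real \<Rightarrow> real"
    and v w :: "real \<Rightarrow> real^'n"
    and \<Omega> :: "real \<Rightarrow> 'w measure"
    and z :: "real \<Rightarrow> 'w \<Rightarrow> real^'n"
  assumes N_ge_2: "CARD('n) \<ge> 2"
    and branch_interval: "\<alpha>0 < \<alpha>c"
    and nbhd: "open U" "\<forall>\<alpha>\<in>{\<alpha>0<..<\<alpha>c}. (xs \<alpha>, \<alpha>) \<in> U" "(xc, \<alpha>c) \<in> U"
    and F_C2: "C2_on (\<lambda>(x, \<alpha>). F x \<alpha>) U"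
    and equilibria: "\<forall>\<alpha>\<in>{\<alpha>0<..<\<alpha>c}. F (xs \<alpha>) \<alpha> = 0"
    and stable: "\<forall>\<alpha>\<in>{\<alpha>0<..<\<alpha>c}. asymptotically_stable_equilibrium (\<lambda>x. F x \<alpha>) (xs \<alpha>)"
    and M_eq: "\<forall>\<alpha>\<in>{\<alpha>0<..<\<alpha>c}. M \<alpha> = - jacobian (\<lambda>x. F x \<alpha>) (at (xs \<alpha>))"
    and xs_lim: "(xs \<longlongrightarrow> xc) (at_left \<alpha>c)"
    and diagonalizable: "\<forall>\<^sub>F \<alpha> in at_left \<alpha>c. is_diagonalizable (complex_matrix (M \<alpha>))"
    and positive_spectrum:
      "\<forall>\<^sub>F \<alpha> in at_left \<alpha>c. \<forall>\<mu>. is_eigenvalue (complex_matrix (M \<alpha>)) \<mu> \<longrightarrow> Re \<mu> > 0"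
    and lambda1_simple:
      "\<forall>\<^sub>F \<alpha> in at_left \<alpha>c.
         is_simple_eigenvalue (complex_matrix (M \<alpha>)) (complex_of_real (lam1 \<alpha>)) \<and> lam1 \<alpha> > 0"
    and lambda1_smallest:
      "\<forall>\<^sub>F \<alpha> in at_left \<alpha>c. \<forall>\<mu>. is_eigenvalue (complex_matrix (M \<alpha>)) \<mu> \<longrightarrow> lam1 \<alpha> \<le> Re \<mu>"
    and lambda1_lim: "(lam1 \<longlongrightarrow> 0) (at_left \<alpha>c)"
    and spectral_gap: "\<delta> > 0"
      "\<forall>\<^sub>F \<alpha> in at_left \<alpha>c. \<forall>\<mu>. is_eigenvalue (complex_matrix (M \<alpha>)) \<mu> \<and>
         \<mu> \<noteq> complex_of_real (lam1 \<alpha>) \<longrightarrow> Re \<mu> \<ge> \<delta>"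
    and eigenvectors:
      "\<forall>\<^sub>F \<alpha> in at_left \<alpha>c.
         M \<alpha> *v v \<alpha> = lam1 \<alpha> *\<^sub>R v \<alpha> \<and> w \<alpha> v* M \<alpha> = lam1 \<alpha> *\<^sub>R w \<alpha> \<and>
         norm (v \<alpha>) = 1 \<and> w \<alpha> \<bullet> v \<alpha> = 1"
    and eigenvectors_lim: "(v \<longlongrightarrow> vc) (at_left \<alpha>c)" "(w \<longlongrightarrow> wc) (at_left \<alpha>c)"
    and lyapunov:
      "\<forall>\<^sub>F \<alpha> in at_left \<alpha>c. M \<alpha> ** C \<alpha> + C \<alpha> ** transpose (M \<alpha>) = B ** transpose B"
    and weight_pos: "total_weight A > 0"
    and sigma_eff_pos: "wc \<bullet> ((B ** transpose B) *v wc) > 0"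
    and rho_less_1: "(\<Sum>i\<in>UNIV. vc $ i)\<^sup>2 / real CARD('n) < 1"
    and gaussian: "\<forall>\<^sub>F \<alpha> in at_left \<alpha>c. gaussian_vector (\<Omega> \<alpha>) (z \<alpha>) 0 (C \<alpha>)"
  shows
    "(\<forall>\<^sub>F \<alpha> in at_left \<alpha>c. square_integrable (\<Omega> \<alpha>) (\<lambda>\<omega>. spatial_skewness (xs \<alpha> + z \<alpha> \<omega>))) \<and>
     ((\<lambda>\<alpha>. std_dev (\<Omega> \<alpha>) (\<lambda>\<omega>. spatial_skewness (xs \<alpha> + z \<alpha> \<omega>))) \<longlongrightarrow>
        \<bar>central_moment 3 vc / (central_moment 2 vc) powr (3/2)\<bar>) (at_left \<alpha>c) \<and>
     L2_converges_to_const \<Omega> (\<lambda>\<alpha> \<omega>. spatial_kurtosis (xs \<alpha> + z \<alpha> \<omega>))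
        (central_moment 4 vc / (central_moment 2 vc)\<^sup>2) (at_left \<alpha>c) \<and>
     L2_converges_to_const \<Omega> (\<lambda>\<alpha> \<omega>. moran_I A (xs \<alpha> + z \<alpha> \<omega>))
        (real CARD('n) / total_weight A *
          ((vc \<bullet> ((centering_matrix ** A ** centering_matrix) *v vc)) /
           (vc \<bullet> (centering_matrix *v vc)))) (at_left \<alpha>c) \<and>
     ((\<lambda>\<alpha>. prob_space.variance (\<Omega> \<alpha>) (\<lambda>\<omega>. spatial_kurtosis (xs \<alpha> + z \<alpha> \<omega>))) \<longlongrightarrow> 0)
        (at_left \<alpha>c) \<and>
     ((\<lambda>\<alpha>. prob_space.variance (\<Omega> \<alpha>) (\<lambda>\<omega>. moran_I A (xs \<alpha> + z \<alpha> \<omega>))) \<longlongrightarrow> 0)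
        (at_left \<alpha>c)"
proof -

  \<comment> \<open>Uniform bounds along the branch\<close>
  let ?F = "at_left \<alpha>c"
  have interval: "\<forall>\<^sub>F \<alpha> in ?F. \<alpha> \<in> {\<alpha>0<..<\<alpha>c}"
    using branch_interval by (rule eventually_at_left_real)
  have "\<forall>\<^sub>F \<alpha> in ?F. (xs \<alpha>, \<alpha>) \<in> U"
    using interval nbhd(2) by (auto elim: eventually_mono)
  then obtain m where "\<forall>\<^sub>F \<alpha> in ?F. \<forall>i j. \<bar>jacobian (\<lambda>x. F x \<alpha>) (at (xs \<alpha>)) $ i $ j\<bar> \<le> m"
    using jacobian_bounded_along_branch[OF F_C2 nbhd(3) _ xs_lim] by blast
  then have m: "\<forall>\<^sub>F \<alpha> in ?F. \<forall>i j. \<bar>M \<alpha> $ i $ j\<bar> \<le> m"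
    using interval by eventually_elim (simp add: M_eq)
  obtain b where b: "\<And>a. norm (a v* B) \<le> b * norm a"
    using bounded_linear.bounded[OF matrix_vector_mul_bounded_linear[of "transpose B"]]
    by (auto simp: mult.commute)
  define K where "K = lyapunov_bound ((real CARD('n))\<^sup>2 * m) b \<delta> (CARD('n) - 1)"
  have K_nonneg: "K \<ge> 0"
    unfolding K_def by (rule lyapunov_bound_nonneg[OF spectral_gap(1)])
  have K: "\<forall>\<^sub>F \<alpha> in ?F. \<forall>a. a \<bullet> v \<alpha> = 0 \<longrightarrow> a \<bullet> (C \<alpha> *v a) \<le> K * (norm a)\<^sup>2"
    using lyapunov gaussian diagonalizable lambda1_simple spectral_gap(2) eigenvectors m
  proof eventually_elim
    case (elim \<alpha>)
    have sym: "transpose (C \<alpha>) = C \<alpha>" and psd: "\<And>u. 0 \<le> u \<bullet> (C \<alpha> *v u)"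
      using elim(2) by (auto simp: gaussian_vector_def)
    have "v \<alpha> \<noteq> 0" using elim(6) by auto
    then show ?case
      unfolding K_def using elim b
      by (intro allI impI complementary_covariance_bound[OF elim(1) sym psd spectral_gap(1) elim(3)]) auto
  qed

  \<comment> \<open>Splitting along the critical direction\<close>
  define s where "s \<alpha> \<omega> = w \<alpha> \<bullet> z \<alpha> \<omega>" for \<alpha> \<omega>
  \<comment> \<open>The equilibrium is counted in the remainder; it stays bounded because the branch
    converges.\<close>
  define r where "r \<alpha> \<omega> = xs \<alpha> + z \<alpha> \<omega> - s \<alpha> \<omega> *\<^sub>R v \<alpha>" for \<alpha> \<omega>
  define \<tau> where "\<tau> \<alpha> = w \<alpha> \<bullet> (C \<alpha> *v w \<alpha>)" for \<alpha>
  have x_eq: "xs \<alpha> + z \<alpha> \<omega> = s \<alpha> \<omega> *\<^sub>R v \<alpha> + r \<alpha> \<omega>" for \<alpha> \<omega>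
    by (simp add: r_def)
  have \<tau>: "filterlim \<tau> at_top ?F"
    unfolding \<tau>_def
  proof (rule critical_variance_at_top[OF lyapunov])
    show "\<forall>\<^sub>F \<alpha> in ?F. transpose (C \<alpha>) = C \<alpha>"
      using gaussian by eventually_elim (simp add: gaussian_vector_def)
    show "\<forall>\<^sub>F \<alpha> in ?F. w \<alpha> v* M \<alpha> = lam1 \<alpha> *\<^sub>R w \<alpha>"
      using eigenvectors by eventually_elim simp
    show "\<forall>\<^sub>F \<alpha> in ?F. 0 < lam1 \<alpha>"
      using lambda1_simple by eventually_elim simp
  qed (fact eigenvectors_lim lambda1_lim sigma_eff_pos)+
  \<comment> \<open>The two increments by 1 leave room for \<open>xs \<alpha>\<close> and
    \<open>w \<alpha>\<close> to exceed the norms of their limits.\<close>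
  define R where "R = 2 * (norm xc + 1)\<^sup>2 + 2 * real CARD('n) * K * (1 + (norm wc + 1))\<^sup>2"
  have xs_bound: "\<forall>\<^sub>F \<alpha> in ?F. norm (xs \<alpha>) < norm xc + 1"
    by (rule order_tendstoD(2)[OF tendsto_norm[OF xs_lim]]) simp
  have w_bound: "\<forall>\<^sub>F \<alpha> in ?F. norm (w \<alpha>) < norm wc + 1"
    by (rule order_tendstoD(2)[OF tendsto_norm[OF eigenvectors_lim(2)]]) simp
  have \<tau>_pos: "\<forall>\<^sub>F \<alpha> in ?F. \<tau> \<alpha> > 0"
    using \<tau> by (simp add: filterlim_at_top_dense)
  \<comment> \<open>The second law is the functional at \<open>- w \<alpha>\<close>, whose variance
    is the same; it supplies the symmetry behind the fair sign.\<close>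
  have law: "distr (\<Omega> \<alpha>) borel (s \<alpha>) = normal_law 0 (\<tau> \<alpha>)"
      "distr (\<Omega> \<alpha>) borel (\<lambda>\<omega>. - s \<alpha> \<omega>) = normal_law 0 (\<tau> \<alpha>)"
    if "gaussian_vector (\<Omega> \<alpha>) (z \<alpha>) 0 (C \<alpha>)" for \<alpha>
  proof -
    have law: "distr (\<Omega> \<alpha>) borel (\<lambda>\<omega>. u \<bullet> z \<alpha> \<omega>) = normal_law 0 (u \<bullet> (C \<alpha> *v u))" for u
      using that by (simp add: gaussian_vector_def)
    show "distr (\<Omega> \<alpha>) borel (s \<alpha>) = normal_law 0 (\<tau> \<alpha>)"
      using law[of "w \<alpha>"] by (simp add: s_def[abs_def] \<tau>_def)
    have "C \<alpha> *v (- w \<alpha>) = - (C \<alpha> *v w \<alpha>)"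
      using matrix_vector_mult_scaleR[of "C \<alpha>" "- 1" "w \<alpha>"] by simp
    then show "distr (\<Omega> \<alpha>) borel (\<lambda>\<omega>. - s \<alpha> \<omega>) = normal_law 0 (\<tau> \<alpha>)"
      using law[of "- w \<alpha>"] by (simp add: s_def[abs_def] \<tau>_def)
  qed
  have remainder: "\<forall>\<^sub>F \<alpha> in ?F. prob_space (\<Omega> \<alpha>) \<and> s \<alpha> \<in> borel_measurable (\<Omega> \<alpha>) \<and> r \<alpha> \<in> borel_measurable (\<Omega> \<alpha>) \<and>
      distr (\<Omega> \<alpha>) borel (s \<alpha>) = normal_law 0 (\<tau> \<alpha>) \<and>
      integrable (\<Omega> \<alpha>) (\<lambda>\<omega>. (norm (r \<alpha> \<omega>))\<^sup>2) \<and> (\<integral>\<omega>. (norm (r \<alpha> \<omega>))\<^sup>2 \<partial>\<Omega> \<alpha>) \<le> R"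
    using gaussian K eigenvectors xs_bound w_bound
  proof eventually_elim
    case (elim \<alpha>)
    have z [measurable]: "z \<alpha> \<in> borel_measurable (\<Omega> \<alpha>)" and prob: "prob_space (\<Omega> \<alpha>)"
      using elim(1) by (auto simp: gaussian_vector_def)
    note bound = gaussian_remainder_bound[OF elim(1) elim(2)[rule_format] K_nonneg, where x="xs \<alpha>" and w="w \<alpha>"]
    have "(\<integral>\<omega>. (norm (r \<alpha> \<omega>))\<^sup>2 \<partial>\<Omega> \<alpha>) \<le> 2 * (norm (xs \<alpha>))\<^sup>2 + 2 * real CARD('n) * K * (1 + norm (w \<alpha>))\<^sup>2"
      unfolding r_def s_def using bound(2) elim(3) by blast
    also have "\<dots> \<le> R"
      unfolding R_def using elim(4,5) K_nonneg by (intro add_mono mult_left_mono power_mono) auto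
    finally show ?case
      using prob law(1)[OF elim(1)] bound(1) elim(3) unfolding r_def s_def by auto
  qed

  \<comment> \<open>The unit norm passes to the limit, so that the assumption on the coordinate sum
    makes \<open>vc\<close> and \<open>- vc\<close> spatially nonconstant, that is, points of
    continuity.\<close>
  have "((\<lambda>\<alpha>. norm (v \<alpha>)) \<longlongrightarrow> norm vc) ?F"
    by (intro tendsto_norm eigenvectors_lim)
  moreover have "((\<lambda>\<alpha>. norm (v \<alpha>)) \<longlongrightarrow> 1) ?F"
    using eigenvectors by (intro tendsto_eventually) (auto elim: eventually_mono)
  ultimately have "norm vc = 1"
    by (rule tendsto_unique[rotated]) simp
  then have "0 < real CARD('n) * central_moment 2 vc"
    using rho_less_1 by (simp add: central_moment_2_eq)
  then have vc: "central_moment 2 vc > 0" "central_moment 2 (- vc) > 0"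
    by (simp_all add: zero_less_mult_iff central_moment_minus)

  \<comment> \<open>Limits of bounded homogeneous statistics\<close>
  have limit: "((\<lambda>\<alpha>. \<integral>\<omega>. (h (xs \<alpha> + z \<alpha> \<omega>) - (if s \<alpha> \<omega> > 0 then h vc else h (- vc)))\<^sup>2 \<partial>\<Omega> \<alpha>) \<longlongrightarrow> 0) ?F"
    if "h \<in> borel_measurable borel" "\<And>x. \<bar>h x\<bar> \<le> G" "isCont h vc" "isCont h (- vc)"
      "\<And>c x. c > 0 \<Longrightarrow> h (c *\<^sub>R x) = h x" for h :: "real^'n \<Rightarrow> real" and G
    unfolding x_eq using remainder
    by (intro homogeneous_L2_limit[OF _ eigenvectors_lim(1) dominated_ratio_tendsto_0[OF remainder \<tau>] that])
      (auto elim: eventually_mono)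
  have square_int: "\<forall>\<^sub>F \<alpha> in ?F. square_integrable (\<Omega> \<alpha>) (\<lambda>\<omega>. h (xs \<alpha> + z \<alpha> \<omega>))"
    if h [measurable]: "h \<in> borel_measurable borel" and G: "\<And>x. \<bar>h x\<bar> \<le> G" for h :: "real^'n \<Rightarrow> real" and G
    using gaussian
  proof eventually_elim
    case (elim \<alpha>)
    then interpret prob_space "\<Omega> \<alpha>" by (simp add: gaussian_vector_def)
    have [measurable]: "z \<alpha> \<in> borel_measurable (\<Omega> \<alpha>)" using elim by (simp add: gaussian_vector_def)
    have "(h y)\<^sup>2 \<le> G\<^sup>2" for y
      using power_mono[OF G, of y 2] by simp
    then have "integrable (\<Omega> \<alpha>) (\<lambda>\<omega>. (h (xs \<alpha> + z \<alpha> \<omega>))\<^sup>2)"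
      by (intro integrable_const_bound[where B="G\<^sup>2"]) auto
    then show ?case by (simp add: square_integrable_def)
  qed
  \<comment> \<open>Invariance under the factor -1 makes the two target values agree. Convergence of
    the mean is recorded as well, for use with the squared skewness.\<close>
  have even: "L2_converges_to_const \<Omega> (\<lambda>\<alpha> \<omega>. h (xs \<alpha> + z \<alpha> \<omega>)) (h vc) ?F"
      "((\<lambda>\<alpha>. prob_space.variance (\<Omega> \<alpha>) (\<lambda>\<omega>. h (xs \<alpha> + z \<alpha> \<omega>))) \<longlongrightarrow> 0) ?F"
      "((\<lambda>\<alpha>. \<integral>\<omega>. h (xs \<alpha> + z \<alpha> \<omega>) \<partial>\<Omega> \<alpha>) \<longlongrightarrow> h vc) ?F"
    if h: "h \<in> borel_measurable borel" "\<And>x. \<bar>h x\<bar> \<le> G" "\<And>x. central_moment 2 x > 0 \<Longrightarrow> isCont h x"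
      and hom: "\<And>c x. c \<noteq> 0 \<Longrightarrow> h (c *\<^sub>R x) = h x" for h :: "real^'n \<Rightarrow> real" and G
  proof -
    note sq = square_int[OF h(1,2)]
    have "h (- vc) = h vc" using hom[of "- 1" vc] by simp
    then have lim: "((\<lambda>\<alpha>. \<integral>\<omega>. (h (xs \<alpha> + z \<alpha> \<omega>) - h vc)\<^sup>2 \<partial>\<Omega> \<alpha>) \<longlongrightarrow> 0) ?F"
      using limit[OF h(1,2) h(3)[OF vc(1)] h(3)[OF vc(2)]] hom by (simp cong: if_cong)
    then show "L2_converges_to_const \<Omega> (\<lambda>\<alpha> \<omega>. h (xs \<alpha> + z \<alpha> \<omega>)) (h vc) ?F"
      using sq by (simp add: L2_converges_to_const_def)
    have bounds: "\<forall>\<^sub>F \<alpha> in ?F.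
        0 \<le> prob_space.variance (\<Omega> \<alpha>) (\<lambda>\<omega>. h (xs \<alpha> + z \<alpha> \<omega>)) \<and>
        prob_space.variance (\<Omega> \<alpha>) (\<lambda>\<omega>. h (xs \<alpha> + z \<alpha> \<omega>)) \<le> (\<integral>\<omega>. (h (xs \<alpha> + z \<alpha> \<omega>) - h vc)\<^sup>2 \<partial>\<Omega> \<alpha>) \<and>
        ((\<integral>\<omega>. h (xs \<alpha> + z \<alpha> \<omega>) \<partial>\<Omega> \<alpha>) - h vc)\<^sup>2 \<le> (\<integral>\<omega>. (h (xs \<alpha> + z \<alpha> \<omega>) - h vc)\<^sup>2 \<partial>\<Omega> \<alpha>)"
      using gaussian sq
    proof eventually_elim
      case (elim \<alpha>)
      then interpret prob_space "\<Omega> \<alpha>" by (simp add: gaussian_vector_def)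
      show ?case
        using elim(2) variance_le_second_moment variance_positive by (auto simp: square_integrable_def)
    qed
    show "((\<lambda>\<alpha>. prob_space.variance (\<Omega> \<alpha>) (\<lambda>\<omega>. h (xs \<alpha> + z \<alpha> \<omega>))) \<longlongrightarrow> 0) ?F"
      using bounds by (intro tendsto_sandwich[OF _ _ tendsto_const lim]) (auto elim: eventually_mono)
    have "((\<lambda>\<alpha>. ((\<integral>\<omega>. h (xs \<alpha> + z \<alpha> \<omega>) \<partial>\<Omega> \<alpha>) - h vc)\<^sup>2) \<longlongrightarrow> 0) ?F"
      using bounds by (intro tendsto_sandwich[OF _ _ tendsto_const lim]) (auto elim: eventually_mono)
    from tendsto_real_sqrt[OF this]
    have "((\<lambda>\<alpha>. (\<integral>\<omega>. h (xs \<alpha> + z \<alpha> \<omega>) \<partial>\<Omega> \<alpha>) - h vc) \<longlongrightarrow> 0) ?F"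
      by (simp add: tendsto_rabs_zero_iff)
    then show "((\<lambda>\<alpha>. \<integral>\<omega>. h (xs \<alpha> + z \<alpha> \<omega>) \<partial>\<Omega> \<alpha>) \<longlongrightarrow> h vc) ?F"
      by (rule LIM_zero_cancel)
  qed

  \<comment> \<open>Second moment and mean of the skewness\<close>
  let ?g = "spatial_skewness :: real^'n \<Rightarrow> real"
  let ?x = "\<lambda>\<alpha> \<omega>. xs \<alpha> + z \<alpha> \<omega>"
  let ?G = "sqrt (real CARD('n)) ^ 3"
  have g2: "((\<lambda>\<alpha>. \<integral>\<omega>. (?g (?x \<alpha> \<omega>))\<^sup>2 \<partial>\<Omega> \<alpha>) \<longlongrightarrow> (?g vc)\<^sup>2) ?F"
  proof (rule even(3)[where G="?G\<^sup>2"])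
    show "\<bar>(?g x)\<^sup>2\<bar> \<le> ?G\<^sup>2" for x
      using power_mono[OF spatial_skewness_bound[of x], of 2] by simp
    show "isCont (\<lambda>x. (?g x)\<^sup>2) x" if "central_moment 2 x > 0" for x
      using isCont_spatial_skewness[OF that] by (intro continuous_intros)
    \<comment> \<open>For negative c, the vector is rewritten as -c times -x; oddness then costs
      only a sign, which the square removes.\<close>
    show "(?g (c *\<^sub>R x))\<^sup>2 = (?g x)\<^sup>2" if "c \<noteq> 0" for c x
      using that spatial_skewness_scaleR[of c x] spatial_skewness_scaleR[of "- c" "- x"]
      by (cases "c > 0") (auto simp: spatial_skewness_minus)
  qed measurable
  \<comment> \<open>The limiting random sign times the constant is centred, so subtracting it leaves
    the mean unchanged; the squared mean is then at most the second moment of the difference, which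
    tends to 0.\<close>
  have "((\<lambda>\<alpha>. (\<integral>\<omega>. ?g (?x \<alpha> \<omega>) \<partial>\<Omega> \<alpha>)\<^sup>2) \<longlongrightarrow> 0) ?F"
  proof (rule tendsto_sandwich[OF _ _ tendsto_const])
    show "((\<lambda>\<alpha>. \<integral>\<omega>. (?g (?x \<alpha> \<omega>) - (if s \<alpha> \<omega> > 0 then ?g vc else ?g (- vc)))\<^sup>2 \<partial>\<Omega> \<alpha>) \<longlongrightarrow> 0) ?F"
      by (rule limit[OF _ spatial_skewness_bound])
        (auto intro: isCont_spatial_skewness vc spatial_skewness_scaleR)
    show "\<forall>\<^sub>F \<alpha> in ?F. (\<integral>\<omega>. ?g (?x \<alpha> \<omega>) \<partial>\<Omega> \<alpha>)\<^sup>2 \<le>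
        (\<integral>\<omega>. (?g (?x \<alpha> \<omega>) - (if s \<alpha> \<omega> > 0 then ?g vc else ?g (- vc)))\<^sup>2 \<partial>\<Omega> \<alpha>)"
      using gaussian \<tau>_pos
    proof eventually_elim
      case (elim \<alpha>)
      then interpret prob_space "\<Omega> \<alpha>" by (simp add: gaussian_vector_def)
      have [measurable]: "z \<alpha> \<in> borel_measurable (\<Omega> \<alpha>)" using elim by (simp add: gaussian_vector_def)
      have s [measurable]: "s \<alpha> \<in> borel_measurable (\<Omega> \<alpha>)" unfolding s_def by measurable
      let ?T = "\<lambda>\<omega>. if s \<alpha> \<omega> > 0 then ?g vc else - ?g vc"
      have "integrable (\<Omega> \<alpha>) (\<lambda>\<omega>. ?g (?x \<alpha> \<omega>))"
        by (intro integrable_const_bound[where B="?G"]) (auto simp: spatial_skewness_bound)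
      moreover have "integrable (\<Omega> \<alpha>) ?T"
        by (intro integrable_const_bound[where B="\<bar>?g vc\<bar>"]) auto
      moreover have "expectation ?T = 0"
        by (rule symmetric_normal_sign_expectation[OF s law[OF elim(1)] elim(2)])
      ultimately have mean: "expectation (\<lambda>\<omega>. ?g (?x \<alpha> \<omega>) - ?T \<omega>) = expectation (\<lambda>\<omega>. ?g (?x \<alpha> \<omega>))"
        by simp
      have "\<bar>?g (?x \<alpha> \<omega>) - ?T \<omega>\<bar> \<le> 2 * ?G" for \<omega>
        using spatial_skewness_bound[of "?x \<alpha> \<omega>"] spatial_skewness_bound[of vc] by auto
      then have "(?g (?x \<alpha> \<omega>) - ?T \<omega>)\<^sup>2 \<le> (2 * ?G)\<^sup>2" for \<omega>
        using power_mono[of "\<bar>?g (?x \<alpha> \<omega>) - ?T \<omega>\<bar>" "2 * ?G" 2] by (simp only: power2_abs abs_ge_zero)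
      then have "integrable (\<Omega> \<alpha>) (\<lambda>\<omega>. (?g (?x \<alpha> \<omega>) - ?T \<omega>)\<^sup>2)"
        by (intro integrable_const_bound[where B="(2 * ?G)\<^sup>2"] AE_I2)
          (simp_all only: real_norm_def abs_power2, measurable)
      from variance_le_second_moment(2)[OF _ this, of 0] show ?case
        by (simp add: mean spatial_skewness_minus cong: if_cong)
    qed
  qed simp
  with g2 have "((\<lambda>\<alpha>. (\<integral>\<omega>. (?g (?x \<alpha> \<omega>))\<^sup>2 \<partial>\<Omega> \<alpha>) - (\<integral>\<omega>. ?g (?x \<alpha> \<omega>) \<partial>\<Omega> \<alpha>)\<^sup>2) \<longlongrightarrow> (?g vc)\<^sup>2 - 0) ?F"
    by (rule tendsto_diff)
  \<comment> \<open>The absolute value in the limit is the square root of the squared skewness of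
    \<open>vc\<close>.\<close>
  then have "((\<lambda>\<alpha>. sqrt ((\<integral>\<omega>. (?g (?x \<alpha> \<omega>))\<^sup>2 \<partial>\<Omega> \<alpha>) - (\<integral>\<omega>. ?g (?x \<alpha> \<omega>) \<partial>\<Omega> \<alpha>)\<^sup>2)) \<longlongrightarrow> \<bar>?g vc\<bar>) ?F"
    using tendsto_real_sqrt by fastforce
  moreover have "\<forall>\<^sub>F \<alpha> in ?F. sqrt ((\<integral>\<omega>. (?g (?x \<alpha> \<omega>))\<^sup>2 \<partial>\<Omega> \<alpha>) - (\<integral>\<omega>. ?g (?x \<alpha> \<omega>) \<partial>\<Omega> \<alpha>)\<^sup>2) =
      std_dev (\<Omega> \<alpha>) (\<lambda>\<omega>. ?g (?x \<alpha> \<omega>))"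
    using gaussian square_int[OF borel_measurable_spatial_skewness spatial_skewness_bound]
  proof eventually_elim
    case (elim \<alpha>)
    then interpret prob_space "\<Omega> \<alpha>" by (simp add: gaussian_vector_def)
    have "integrable (\<Omega> \<alpha>) (\<lambda>\<omega>. ?g (?x \<alpha> \<omega>))"
      using elim(2) unfolding square_integrable_def by (blast intro: square_integrable_imp_integrable)
    then show ?case
      using elim(2) by (simp add: std_dev_def variance_eq square_integrable_def)
  qed
  ultimately have skewness: "((\<lambda>\<alpha>. std_dev (\<Omega> \<alpha>) (\<lambda>\<omega>. ?g (?x \<alpha> \<omega>))) \<longlongrightarrow> \<bar>?g vc\<bar>) ?F"
    by (rule Lim_transform_eventually)
  note kurtosis = even[OF borel_measurable_spatial_kurtosis spatial_kurtosis_bound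
      isCont_spatial_kurtosis spatial_kurtosis_scaleR]
  note moran = even[OF borel_measurable_moran_I moran_I_bound isCont_moran_I moran_I_scaleR, of A]
  show ?thesis
    using square_int[OF borel_measurable_spatial_skewness spatial_skewness_bound]
      skewness[unfolded spatial_skewness_def[of vc]] kurtosis(1)[unfolded spatial_kurtosis_def[of vc]]
      moran(1)[unfolded moran_I_eq_quadratic_forms[of A vc]] kurtosis(2) moran(2)
    by blast
qed

end
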